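(* Let $d=2$, $p,q\ge1$, and let the DOFs $U_\kappa^{ij}(t_{n-1}^q)$ lie in $[m,M]$. Let $U_\kappa^{ij}(t_n^r)\in[m,M]$ be the solution of the space-time DGSEM on the time slab $(t^{(n)},t^{(n+1)})$, $\Delta t^{(n)}=t^{(n+1)}-t^{(n)}>0$: for all $\kappa\in\Omega_h$, $0\le i,j\le p$, $0\le r\le q$, $$\omega_i\omega_jJ_\kappa^{ij}\,T_\kappa^r\big(u_h(\mathbf x_\kappa^{ij},\cdot)\big)+\frac{\omega_r\Delta t^{(n)}}2\Big(R_\kappa^{ij}\big(u_h(\cdot,t_n^r)\big)+V_\kappa^{ij}\big(u_h(\cdot,t_n^r)\big)\Big)=0,$$ where the entropy conservative fluxes $h_{ec}$ (in space) and $U_{ec}$ (in time) are those associated with a given entropy pair $(\vartheta,\mathbf g)$ with $\vartheta''>0$, and the graph viscosity coefficients $d_\kappa$ (in $V_\kappa^{ij}$) and $d_n$ (in $T_\kappa^r$) satisfy $$d_\kappa\ge4L_fL_u\max_{k\ne l}\frac{|D^p_{kl}|}{\omega_l}\quad\forall\kappa\in\Omega_h,\qquad d_n\ge2L_u\max_{r\ne m}\frac{|D^q_{rm}|}{\omega_m}\quad\forall n\ge0,$$ with $L_u:=\sup_{m\le u^+\ne u^-\le M}\frac{\vartheta''(u^+)(u^+-u^-)}{v(u^+)-v(u^-)}$, $v=\vartheta'$. Then for every entropy pair $(\eta,\mathbf q)$ with $\eta''\ge0$ and every $\kappa\in\Omega_h$, $$\langle\eta(u_h(t_n^q))\rangle_\kappa\le\langle\eta(u_h(t_{n-1}^q))\rangle_\kappa-\frac{\Delta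 t^{(n)}}{|\kappa|}\sum_{r=0}^q\frac{\omega_r}2\sum_{e\in\partial\kappa}\sum_{k=0}^p\omega_kJ_e^k\,Q\big(u_h^-(\mathbf x_e^k,t_n^r),u_h^+(\mathbf x_e^k,t_n^r),\mathbf n_e^k\big),$$ where $Q$ is the numerical entropy flux associated with $h$ and $(\eta,\mathbf q)$.
   Context: **Continuous problem.** $\partial_tu+\nabla\cdot\mathbf f(u)=0$ in $\Omega\times(0,\infty)$, $u(\cdot,0)=u_0$, with $\Omega\subset\mathbb R^2$, $\mathbf f:\mathbb R\to\mathbb R^2$ locally Lipschitz, $u_0\in L^\infty$, $m:=\operatorname{ess\,inf}u_0$, $M:=\operatorname{ess\,sup}u_0$ (when $m$ appears as a summation or matrix index it is an integer in $\{0,\dots,q\}$). Lipschitz constant of the flux: $L_f:=\sup_{m\le u^+\neq u^-\le M}\sup_{\mathbf n\in\mathbb S^{1}}\frac{|(\mathbf f(u^+)-\mathbf f(u^-))\cdot\mathbf n|}{|u^+-u^-|}$. An entropy pair $(\eta,\mathbf q)$ means $\eta$ convex and $\mathbf q(u)=\int^u\eta'(w)\mathbf f'(w)\,dw$. **One-dimensional operators.** For a degree $s\ge1$ ($s=p$ in space, $s=q$ in time): $-1=\xi_0<\dots<\xi_s=1$ are the $s+1$ Gauss-Lobatto nodes on $I=[-1,1]$, $\omega_k>0$ the associated quadrature weights ($\sum_k\omega_k=2$), $\ell_k$ the Lagrange polynomials with $\ell_k(\xi_l)=\delta_{kl}$; $D^s_{kl}=\ell_l'(\xi_k)$, $Q^s_{kl}=\omega_kD^s_{kl}$.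 The dependence of nodes/weights on $s$ is dropped: indices $i,j,k,l\in\{0,\dots,p\}$ refer to the degree-$p$ rule and indices $r,m\in\{0,\dots,q\}$ to the degree-$q$ rule. **Mesh.** $\Omega_h$ is a mesh of nonoverlapping nonempty open elements $\kappa$ partitioning $\Omega$ (possibly countably infinitely many). Each $\kappa$ is the image of $I^2$ under a mapping $\mathbf x_\kappa(\xi,\zeta)=\sum_{i,j=0}^p\ell_i(\xi)\ell_j(\zeta)\mathbf x_\kappa^{ij}$, with $\mathbf x_\kappa^{ij}=\mathbf x_\kappa(\xi_i,\xi_j)$ and $J_\kappa^{ij}=\det\mathbf x_\kappa'(\xi_i,\xi_j)>0$. Each edge $e\subset\partial\kappa$ is the image of $I$ under $\mathbf x_e$; $\mathbf x_e^k=\mathbf x_e(\xi_k)$, $J_e^k=|\mathbf x_e'(\xi_k)|>0$, $\mathbf n_e^k$ is the unit normal to $e$ at $\mathbf x_e^k$ pointing outward from $\kappa$. Metric terms ($\nabla\xi,\nabla\zeta$ are the physical gradients of the reference coordinates): $\mathbf n_\kappa^{(ik)j}=\frac12\big(J_\kappa^{ij}\nabla\xi(\xi_i,\xi_j)+J_\kappa^{kj}\nabla\xi(\xi_k,\xi_j)\big)$, $\mathbf n_\kappa^{i(jk)}=\frac12\big(J_\kappa^{ij}\nabla\zeta(\xi_i,\xi_j)+J_\kappa^{ik}\nabla\zeta(\xi_i,\xi_k)\big)$. The discrete metric identities hold: $\sum_{k=0}^p D^p_{ik}\mathbf n_\kappa^{(ik)j}+D^p_{jk}\mathbf n_\kappa^{i(jk)}=0$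 for all $\kappa,i,j$. The mesh is watertight (geometry continuous across faces, face nodes of neighbours coincide) and at faces $\mathbf n_\kappa^{(pp)j}=J_e\mathbf n_e$ at $\mathbf x_\kappa^{pj}$, $\mathbf n_\kappa^{(00)j}=-J_e\mathbf n_e$ at $\mathbf x_\kappa^{0j}$, $\mathbf n_\kappa^{i(pp)}=J_e\mathbf n_e$ at $\mathbf x_\kappa^{ip}$, $\mathbf n_\kappa^{i(00)}=-J_e\mathbf n_e$ at $\mathbf x_\kappa^{i0}$. Every face is shared with a neighbouring element. Mesh regularity: $h:=\sup_\kappa\operatorname{diam}\kappa<\infty$ and there is a finite constant $b>0$ with $J_\kappa^{ij}\ge\frac{b}{2d}h^d$ and $\frac1{4db}h^{d-1}\ge J_e^k,|\mathbf n_\kappa^{(ik)j}|,|\mathbf n_\kappa^{i(jk)}|>0$ for all $\kappa,i,j,k$ (here $d=2$). **Discrete functions.** $u_h(\mathbf x,t)=\sum_{i,j=0}^p\sum_{r=0}^q\phi_\kappa^{ij}(\mathbf x)\phi_n^r(t)U_\kappa^{ij}(t_n^r)$ on $\kappa\times(t^{(n)},t^{(n+1)})$, with $\phi_\kappa^{ij}(\mathbf x_\kappa(\xi,\zeta))=\ell_i(\xi)\ell_j(\zeta)$, $\phi_n^r(t)=\ell_r\big(2\frac{t-t^{(n)}}{\Delta t^{(n)}}-1\big)$, $t_n^r=t^{(n)}+\frac{\Delta t^{(n)}}2(1+\xi_r)$; thus $t_n^0=t^{(n)+}$, $t_n^q=t^{(n+1)-}$, $t^{(0)}=0$. The initial data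 are $U_\kappa^{ij}(t_{-1}^q)=u_0(\mathbf x_\kappa^{ij})\in[m,M]$. At a face node $\mathbf x_e^k$, $e\subset\partial\kappa$, $u_h^-$ is the trace from $\kappa$ and $u_h^+$ the trace from the neighbour; $\phi_\kappa^{ij}(\mathbf x_e^k)=1$ if $\mathbf x_\kappa^{ij}=\mathbf x_e^k$ and $0$ otherwise. Cell average (by quadrature): $|\kappa|=\sum_{i,j}\omega_i\omega_jJ_\kappa^{ij}$, $\langle\eta(u_h(t))\rangle_\kappa=\sum_{0\le i,j\le p}\omega_i\omega_j\frac{J_\kappa^{ij}}{|\kappa|}\eta(U_\kappa^{ij}(t))$. **Space discretization** (evaluated at each fixed time $t_n^r$, writing $U_\kappa^{ij}$ for the DOFs at that time): $$R_\kappa^{ij}(u_h)=2\Big(\omega_j\sum_{k=0}^pQ^p_{ik}h_{ec}(U_\kappa^{ij},U_\kappa^{kj},\mathbf n_\kappa^{(ik)j})+\omega_i\sum_{k=0}^pQ^p_{jk}h_{ec}(U_\kappa^{ij},U_\kappa^{ik},\mathbf n_\kappa^{i(jk)})\Big)+\sum_{e\in\partial\kappa}\sum_{k=0}^p\phi_\kappa^{ij}(\mathbf x_e^k)\omega_kJ_e^k\Big(h(U_\kappa^{ij},u_h^+(\mathbf x_e^k),\mathbf n_e^k)-\mathbf f(U_\kappa^{ij})\cdot\mathbf n_e^k\Big),$$ $$V_\kappa^{ij}(u_h)=d_\kappa\omega_i\omega_j\sum_{k=0}^p\Big(\frac{\omega_k}2|\mathbf n_\kappa^{(ik)j}|(U_\kappa^{ij}-U_\kappa^{kj})+\frac{\omega_k}2|\mathbf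 n_\kappa^{i(jk)}|(U_\kappa^{ij}-U_\kappa^{ik})\Big).$$ **Time discretization.** $$T_\kappa^r\big(u_h(\mathbf x_\kappa^{ij},\cdot)\big)=\sum_{m=0}^q2Q^q_{rm}U_{ec}\big(U_\kappa^{ij}(t_n^r),U_\kappa^{ij}(t_n^m)\big)+\delta_{r0}\big(U_\kappa^{ij}(t_n^0)-U_\kappa^{ij}(t_{n-1}^q)\big)+d_n\omega_r\sum_{m=0}^q\omega_m\big(U_\kappa^{ij}(t_n^r)-U_\kappa^{ij}(t_n^m)\big),$$ with $U_{ec}(u^-,u^+)=\int_0^1u\big(\theta v(u^+)+(1-\theta)v(u^-)\big)d\theta$, where $v(u)=\vartheta'(u)$ and $u(\cdot)$ denotes the inverse function of $v$. **Cell flux $h_{ec}$.** With $\mathbf g(u)=\int^u\vartheta'(w)\mathbf f'(w)\,dw$ and $\boldsymbol\psi(u)=v(u)\mathbf f(u)-\mathbf g(u)$, $h_{ec}$ is smooth, consistent ($h_{ec}(u,u,\mathbf n)=\mathbf f(u)\cdot\mathbf n$), symmetric in its first two arguments, linear in $\mathbf n\in\mathbb R^2$, and entropy conservative: $(v(u^+)-v(u^-))h_{ec}(u^-,u^+,\mathbf n)=(\boldsymbol\psi(u^+)-\boldsymbol\psi(u^-))\cdot\mathbf n$. **Interface flux $h$ and entropy flux $Q$.** $h$ is Lipschitz continuous, consistent ($h(u,u,\mathbf n)=\mathbf f(u)\cdot\mathbf n$), conservative ($h(u^-,u^+,\mathbf n)=-h(u^+,u^-,-\mathbf n)$), and monotone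 (nondecreasing in $u^-$, nonincreasing in $u^+$); its Lipschitz constants $L_1,L_2$ in its first two arguments satisfy $L_1+L_2\ge L_f$. For all $u^-,u,u^+\in[m,M]$, $\mathbf n\in\mathbb S^1$, $\alpha\ge L_f$: $m\le u-\frac{h(u,u^+,\mathbf n)-h(u^-,u,\mathbf n)}{2\alpha}\le M$, and for each convex entropy pair $(\eta,\mathbf q)$, $\eta\big(u-\frac{h(u,u^+,\mathbf n)-h(u^-,u,\mathbf n)}{2\alpha}\big)\le\eta(u)-\frac{Q(u,u^+,\mathbf n)-Q(u^-,u,\mathbf n)}{2\alpha}$, where $Q$ is the associated numerical entropy flux, consistent ($Q(u,u,\mathbf n)=\mathbf q(u)\cdot\mathbf n$) and conservative ($Q(u^-,u^+,\mathbf n)=-Q(u^+,u^-,-\mathbf n)$). *)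

theory Defs
  imports "HOL-Analysis.Analysis" "HOL-Probability.Essential_Supremum"
    "HOL-Computational_Algebra.Polynomial"
begin

section \<open>Gauss-Lobatto rules and one-dimensional operators\<close>

record quad =
  degr :: nat
  pt :: "nat \<Rightarrow> real"
  wt :: "nat \<Rightarrow> real"

text \<open>The Gauss-Lobatto rule of degree \<open>s\<close>: the quadrature rule on \<open>[-1,1]\<close> with \<open>s + 1\<close> nodes, among
  them both end points, that is exact for all polynomials of degree at most \<open>2 s - 1\<close>. These
  requirements determine the nodes and weights.\<close>

definition gauss_lobatto :: "quad \<Rightarrow> bool" where
  "gauss_lobatto S \<longleftrightarrow>
     pt S 0 = -1 \<and> pt S (degr S) = 1 \<and> (\<forall>k<degr S. pt S k < pt S (Suc k)) \<and>
     (\<forall>k\<le>degr S. 0 < wt S k) \<and>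
     (\<forall>P :: real poly. degree P \<le> 2 * degr S - 1 \<longrightarrow>
        (poly P has_integral (\<Sum>k\<le>degr S. wt S k * poly P (pt S k))) {-1..1})"

definition lag :: "quad \<Rightarrow> nat \<Rightarrow> real poly" where
  "lag S k = (\<Prod>l\<in>{..degr S} - {k}. smult (1 / (pt S k - pt S l)) [:- pt S l, 1:])"

definition Dmat :: "quad \<Rightarrow> nat \<Rightarrow> nat \<Rightarrow> real" where
  "Dmat S k l = poly (pderiv (lag S l)) (pt S k)"

definition Qmat :: "quad \<Rightarrow> nat \<Rightarrow> nat \<Rightarrow> real" where
  "Qmat S k l = wt S k * Dmat S k l"

definition max_D :: "quad \<Rightarrow> real" where
  "max_D S = Max {\<bar>Dmat S k l\<bar> / wt S l | k l. k \<le> degr S \<and> l \<le> degr S \<and> k \<noteq> l}"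


section \<open>Meshes\<close>

text \<open>Elements and edges are represented by themselves, as subsets of the plane. A mesh carries the
  Gauss-Lobatto rule used in space, the set of elements, the nodes \<open>x\<^sub>\<kappa>\<^sup>i\<^sup>j\<close> of every element,
  the parametrization \<open>x\<^sub>e\<close> of every edge over \<open>[-1,1]\<close>, and the normals: \<open>nrm G \<kappa> e k\<close> is
  the normal to \<open>e\<close> at \<open>x\<^sub>e\<^sup>k\<close> seen from \<open>\<kappa>\<close>.\<close>

record mesh =
  sp :: quad
  elems :: "(real^2) set set"
  node :: "(real^2) set \<Rightarrow> nat \<Rightarrow> nat \<Rightarrow> real^2"
  emap :: "(real^2) set \<Rightarrow> real \<Rightarrow> real^2"
  nrm :: "(real^2) set \<Rightarrow> (real^2) set \<Rightarrow> nat \<Rightarrow> real^2"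

definition xmap :: "mesh \<Rightarrow> (real^2) set \<Rightarrow> real^2 \<Rightarrow> real^2" where
  "xmap G \<kappa> z = (\<Sum>i\<le>degr (sp G). \<Sum>j\<le>degr (sp G).
      (poly (lag (sp G) i) (z$1) * poly (lag (sp G) j) (z$2)) *\<^sub>R node G \<kappa> i j)"

definition jac :: "mesh \<Rightarrow> (real^2) set \<Rightarrow> nat \<Rightarrow> nat \<Rightarrow> real^2^2" where
  "jac G \<kappa> i j =
     matrix (frechet_derivative (xmap G \<kappa>) (at (vector [pt (sp G) i, pt (sp G) j])))"

definition Jdet :: "mesh \<Rightarrow> (real^2) set \<Rightarrow> nat \<Rightarrow> nat \<Rightarrow> real" where
  "Jdet G \<kappa> i j = det (jac G \<kappa> i j)"

text \<open>The reference coordinates as functions of the physical point are the components of the inverse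
  of the element mapping, so that their gradients are the rows of the inverse Jacobian matrix.\<close>

definition grad_xi :: "mesh \<Rightarrow> (real^2) set \<Rightarrow> nat \<Rightarrow> nat \<Rightarrow> real^2" where
  "grad_xi G \<kappa> i j = row 1 (matrix_inv (jac G \<kappa> i j))"

definition grad_zeta :: "mesh \<Rightarrow> (real^2) set \<Rightarrow> nat \<Rightarrow> nat \<Rightarrow> real^2" where
  "grad_zeta G \<kappa> i j = row 2 (matrix_inv (jac G \<kappa> i j))"

text \<open>\<open>n_xi G \<kappa> i k j\<close> is \<open>n\<^sub>\<kappa>\<^bsup>(ik)j\<^esup>\<close> and \<open>n_zeta G \<kappa> i j k\<close> is \<open>n\<^sub>\<kappa>\<^bsup>i(jk)\<^esup>\<close>.\<close>

definition n_xi :: "mesh \<Rightarrow> (real^2) set \<Rightarrow> nat \<Rightarrow> nat \<Rightarrow> nat \<Rightarrow> real^2" where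
  "n_xi G \<kappa> i k j =
     (1/2) *\<^sub>R (Jdet G \<kappa> i j *\<^sub>R grad_xi G \<kappa> i j + Jdet G \<kappa> k j *\<^sub>R grad_xi G \<kappa> k j)"

definition n_zeta :: "mesh \<Rightarrow> (real^2) set \<Rightarrow> nat \<Rightarrow> nat \<Rightarrow> nat \<Rightarrow> real^2" where
  "n_zeta G \<kappa> i j k =
     (1/2) *\<^sub>R (Jdet G \<kappa> i j *\<^sub>R grad_zeta G \<kappa> i j + Jdet G \<kappa> i k *\<^sub>R grad_zeta G \<kappa> i k)"

datatype side = West | East | South | North

fun side_pt :: "side \<Rightarrow> real \<Rightarrow> real^2" where
  "side_pt West s = vector [-1, s]"
| "side_pt East s = vector [1, s]"
| "side_pt South s = vector [s, -1]"
| "side_pt North s = vector [s, 1]"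

definition edge :: "mesh \<Rightarrow> (real^2) set \<Rightarrow> side \<Rightarrow> (real^2) set" where
  "edge G \<kappa> \<sigma> = (\<lambda>s. xmap G \<kappa> (side_pt \<sigma> s)) ` {-1..1}"

definition edges :: "mesh \<Rightarrow> (real^2) set \<Rightarrow> (real^2) set set" where
  "edges G \<kappa> = edge G \<kappa> ` {West, East, South, North}"

definition xe :: "mesh \<Rightarrow> (real^2) set \<Rightarrow> nat \<Rightarrow> real^2" where
  "xe G e k = emap G e (pt (sp G) k)"

definition Je :: "mesh \<Rightarrow> (real^2) set \<Rightarrow> nat \<Rightarrow> real" where
  "Je G e k = norm (vector_derivative (emap G e) (at (pt (sp G) k) within {-1..1}))"

definition neighbour :: "mesh \<Rightarrow> (real^2) set \<Rightarrow> (real^2) set \<Rightarrow> (real^2) set" where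
  "neighbour G \<kappa> e = (THE \<kappa>'. \<kappa>' \<in> elems G \<and> \<kappa>' \<noteq> \<kappa> \<and> e \<in> edges G \<kappa>')"

text \<open>\<open>n\<close> is a unit vector orthogonal to the tangent \<open>\<tau>\<close> that points out of \<open>\<kappa>\<close> at the boundary
  point \<open>x\<close>, in the sense that the directions leading from \<open>x\<close> into \<open>\<kappa>\<close> make, in the limit, no acute
  angle with it. Unlike conditions on the points \<open>x + \<epsilon> n\<close> and \<open>x - \<epsilon> n\<close>, this is also correct when
  \<open>x\<close> is a vertex of \<open>\<kappa>\<close>.\<close>

definition outward_unit_normal :: "(real^2) set \<Rightarrow> real^2 \<Rightarrow> real^2 \<Rightarrow> real^2 \<Rightarrow> bool" where
  "outward_unit_normal \<kappa> x \<tau> n \<longleftrightarrow> norm n = 1 \<and> n \<bullet> \<tau> = 0 \<and>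
     (\<forall>\<epsilon>>0. \<exists>\<delta>>0. \<forall>y\<in>\<kappa>. dist y x < \<delta> \<longrightarrow> n \<bullet> (y - x) \<le> \<epsilon> * norm (y - x))"

definition mesh_size :: "mesh \<Rightarrow> real" where
  "mesh_size G = (SUP \<kappa>\<in>elems G. diameter \<kappa>)"

text \<open>Since elements are open, an element is the image of the open reference square; its closure is
  then the image of the closed one. Injectivity on the closed square is what makes the basis
  functions \<open>\<phi>\<^sub>\<kappa>\<^sup>i\<^sup>j\<close> below well defined. The edge parametrization is shared by the two adjacent elements
  and agrees with the trace of either element mapping up to the orientation of the edge.\<close>

locale dg_mesh =
  fixes G :: mesh and \<Omega> :: "(real^2) set"
  assumes rule: "gauss_lobatto (sp G)"
    and elem_open: "\<And>\<kappa>. \<kappa> \<in> elems G \<Longrightarrow> open \<kappa> \<and> \<kappa> \<noteq> {}"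
    and elem_image: "\<And>\<kappa>. \<kappa> \<in> elems G \<Longrightarrow> \<kappa> = xmap G \<kappa> ` box (-1) 1"
    and elem_inj: "\<And>\<kappa>. \<kappa> \<in> elems G \<Longrightarrow> inj_on (xmap G \<kappa>) (cbox (-1) 1)"
    and nonoverlapping: "disjoint (elems G)"
    and partition: "\<Union> (elems G) \<subseteq> \<Omega>" "\<Omega> \<subseteq> (\<Union>\<kappa>\<in>elems G. closure \<kappa>)"
    and J_pos: "\<And>\<kappa> i j. \<kappa> \<in> elems G \<Longrightarrow> i \<le> degr (sp G) \<Longrightarrow> j \<le> degr (sp G) \<Longrightarrow>
       0 < Jdet G \<kappa> i j"
    and edge_image: "\<And>\<kappa> e. \<kappa> \<in> elems G \<Longrightarrow> e \<in> edges G \<kappa> \<Longrightarrow> e = emap G e ` {-1..1}"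
    and Je_pos: "\<And>\<kappa> e k. \<kappa> \<in> elems G \<Longrightarrow> e \<in> edges G \<kappa> \<Longrightarrow> k \<le> degr (sp G) \<Longrightarrow> 0 < Je G e k"
    and shared: "\<And>\<kappa> e. \<kappa> \<in> elems G \<Longrightarrow> e \<in> edges G \<kappa> \<Longrightarrow>
       \<exists>!\<kappa>'. \<kappa>' \<in> elems G \<and> \<kappa>' \<noteq> \<kappa> \<and> e \<in> edges G \<kappa>'"
    and watertight: "\<And>\<kappa> \<sigma>. \<kappa> \<in> elems G \<Longrightarrow>
       (\<forall>s\<in>{-1..1}. emap G (edge G \<kappa> \<sigma>) s = xmap G \<kappa> (side_pt \<sigma> s)) \<or>
       (\<forall>s\<in>{-1..1}. emap G (edge G \<kappa> \<sigma>) s = xmap G \<kappa> (side_pt \<sigma> (- s)))"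
    and face_nodes: "\<And>\<kappa> e. \<kappa> \<in> elems G \<Longrightarrow> e \<in> edges G \<kappa> \<Longrightarrow>
       xe G e ` {..degr (sp G)} =
         {node G \<kappa> i j | i j. i \<le> degr (sp G) \<and> j \<le> degr (sp G)} \<inter> e"
    and normals: "\<And>\<kappa> e k. \<kappa> \<in> elems G \<Longrightarrow> e \<in> edges G \<kappa> \<Longrightarrow> k \<le> degr (sp G) \<Longrightarrow>
       outward_unit_normal \<kappa> (xe G e k)
         (vector_derivative (emap G e) (at (pt (sp G) k) within {-1..1})) (nrm G \<kappa> e k)"
    and face_east: "\<And>\<kappa> j k. \<kappa> \<in> elems G \<Longrightarrow> j \<le> degr (sp G) \<Longrightarrow> k \<le> degr (sp G) \<Longrightarrow>
       xe G (edge G \<kappa> East) k = node G \<kappa> (degr (sp G)) j \<Longrightarrow>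
       n_xi G \<kappa> (degr (sp G)) (degr (sp G)) j =
         Je G (edge G \<kappa> East) k *\<^sub>R nrm G \<kappa> (edge G \<kappa> East) k"
    and face_west: "\<And>\<kappa> j k. \<kappa> \<in> elems G \<Longrightarrow> j \<le> degr (sp G) \<Longrightarrow> k \<le> degr (sp G) \<Longrightarrow>
       xe G (edge G \<kappa> West) k = node G \<kappa> 0 j \<Longrightarrow>
       n_xi G \<kappa> 0 0 j = - (Je G (edge G \<kappa> West) k *\<^sub>R nrm G \<kappa> (edge G \<kappa> West) k)"
    and face_north: "\<And>\<kappa> i k. \<kappa> \<in> elems G \<Longrightarrow> i \<le> degr (sp G) \<Longrightarrow> k \<le> degr (sp G) \<Longrightarrow>
       xe G (edge G \<kappa> North) k = node G \<kappa> i (degr (sp G)) \<Longrightarrow>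
       n_zeta G \<kappa> i (degr (sp G)) (degr (sp G)) =
         Je G (edge G \<kappa> North) k *\<^sub>R nrm G \<kappa> (edge G \<kappa> North) k"
    and face_south: "\<And>\<kappa> i k. \<kappa> \<in> elems G \<Longrightarrow> i \<le> degr (sp G) \<Longrightarrow> k \<le> degr (sp G) \<Longrightarrow>
       xe G (edge G \<kappa> South) k = node G \<kappa> i 0 \<Longrightarrow>
       n_zeta G \<kappa> i 0 0 = - (Je G (edge G \<kappa> South) k *\<^sub>R nrm G \<kappa> (edge G \<kappa> South) k)"
    and metric_identities: "\<And>\<kappa> i j. \<kappa> \<in> elems G \<Longrightarrow> i \<le> degr (sp G) \<Longrightarrow> j \<le> degr (sp G) \<Longrightarrow>
       (\<Sum>k\<le>degr (sp G). Dmat (sp G) i k *\<^sub>R n_xi G \<kappa> i k j + Dmat (sp G) j k *\<^sub>R n_zeta G \<kappa> i j k) = 0"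
    and finite_size: "bdd_above (diameter ` elems G)"
    and regularity: "\<exists>b>0. \<forall>\<kappa>\<in>elems G. \<forall>i\<le>degr (sp G). \<forall>j\<le>degr (sp G). \<forall>k\<le>degr (sp G).
       Jdet G \<kappa> i j \<ge> b / (2 * 2) * mesh_size G ^ 2 \<and>
       (\<forall>e\<in>edges G \<kappa>. Je G e k \<le> 1 / (4 * 2 * b) * mesh_size G) \<and>
       0 < norm (n_xi G \<kappa> i k j) \<and> norm (n_xi G \<kappa> i k j) \<le> 1 / (4 * 2 * b) * mesh_size G \<and>
       0 < norm (n_zeta G \<kappa> i j k) \<and> norm (n_zeta G \<kappa> i j k) \<le> 1 / (4 * 2 * b) * mesh_size G"


section \<open>Discrete functions\<close>

definition phi :: "mesh \<Rightarrow> (real^2) set \<Rightarrow> nat \<Rightarrow> nat \<Rightarrow> real^2 \<Rightarrow> real" where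
  "phi G \<kappa> i j x = (let z = inv_into (cbox (-1) 1) (xmap G \<kappa>) x in
     poly (lag (sp G) i) (z$1) * poly (lag (sp G) j) (z$2))"

definition phi_time :: "quad \<Rightarrow> (nat \<Rightarrow> real) \<Rightarrow> nat \<Rightarrow> nat \<Rightarrow> real \<Rightarrow> real" where
  "phi_time T t n r \<tau> = poly (lag T r) (2 * (\<tau> - t n) / (t (Suc n) - t n) - 1)"

definition time_node :: "quad \<Rightarrow> (nat \<Rightarrow> real) \<Rightarrow> nat \<Rightarrow> nat \<Rightarrow> real" where
  "time_node T t n r = t n + (t (Suc n) - t n) / 2 * (1 + pt T r)"

text \<open>Degrees of freedom at a fixed time are a function \<open>W \<kappa> i j\<close>; the space-time ones are
  \<open>U n r \<kappa> i j\<close>, the value \<open>U\<^sub>\<kappa>\<^sup>i\<^sup>j\<close> at the node \<open>r\<close> of the time slab \<open>n\<close>. Both functions below are the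
  polynomial on the closed element \<open>\<kappa>\<close> (resp. on its closed time slab), so their values at
  points of the boundary are the traces from within.\<close>

definition u_space :: "mesh \<Rightarrow> ((real^2) set \<Rightarrow> nat \<Rightarrow> nat \<Rightarrow> real) \<Rightarrow> (real^2) set \<Rightarrow> real^2 \<Rightarrow> real" where
  "u_space G W \<kappa> x = (\<Sum>i\<le>degr (sp G). \<Sum>j\<le>degr (sp G). phi G \<kappa> i j x * W \<kappa> i j)"

definition u_h :: "mesh \<Rightarrow> quad \<Rightarrow> (nat \<Rightarrow> real) \<Rightarrow>
    (nat \<Rightarrow> nat \<Rightarrow> (real^2) set \<Rightarrow> nat \<Rightarrow> nat \<Rightarrow> real) \<Rightarrow> nat \<Rightarrow> (real^2) set \<Rightarrow> real^2 \<Rightarrow> real \<Rightarrow> real" where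
  "u_h G T t U n \<kappa> x \<tau> = (\<Sum>i\<le>degr (sp G). \<Sum>j\<le>degr (sp G). \<Sum>r\<le>degr T.
     phi G \<kappa> i j x * phi_time T t n r \<tau> * U n r \<kappa> i j)"

text \<open>The degrees of freedom at the end of the previous slab, which for the first slab are the
  point values of the initial datum.\<close>

definition U_prev :: "mesh \<Rightarrow> quad \<Rightarrow> (real^2 \<Rightarrow> real) \<Rightarrow>
    (nat \<Rightarrow> nat \<Rightarrow> (real^2) set \<Rightarrow> nat \<Rightarrow> nat \<Rightarrow> real) \<Rightarrow> nat \<Rightarrow> (real^2) set \<Rightarrow> nat \<Rightarrow> nat \<Rightarrow> real" where
  "U_prev G T u0 U n \<kappa> i j =
     (case n of 0 \<Rightarrow> u0 (node G \<kappa> i j) | Suc n' \<Rightarrow> U n' (degr T) \<kappa> i j)"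

definition cell_measure :: "mesh \<Rightarrow> (real^2) set \<Rightarrow> real" where
  "cell_measure G \<kappa> =
     (\<Sum>i\<le>degr (sp G). \<Sum>j\<le>degr (sp G). wt (sp G) i * wt (sp G) j * Jdet G \<kappa> i j)"

definition cell_avg ::
    "mesh \<Rightarrow> (real \<Rightarrow> real) \<Rightarrow> ((real^2) set \<Rightarrow> nat \<Rightarrow> nat \<Rightarrow> real) \<Rightarrow> (real^2) set \<Rightarrow> real" where
  "cell_avg G \<eta> W \<kappa> = (\<Sum>i\<le>degr (sp G). \<Sum>j\<le>degr (sp G).
     wt (sp G) i * wt (sp G) j * (Jdet G \<kappa> i j / cell_measure G \<kappa>) * \<eta> (W \<kappa> i j))"


section \<open>Fluxes and entropies\<close>

definition locally_lipschitz :: "(real \<Rightarrow> real^2) \<Rightarrow> bool" where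
  "locally_lipschitz f \<longleftrightarrow> (\<forall>u. \<exists>\<delta>>0. \<exists>L. L-lipschitz_on (cball u \<delta>) f)"

definition L_flux :: "real \<Rightarrow> real \<Rightarrow> (real \<Rightarrow> real^2) \<Rightarrow> real" where
  "L_flux m M f = Sup {\<bar>(f u - f w) \<bullet> n\<bar> / \<bar>u - w\<bar> | u w n.
     u \<in> {m..M} \<and> w \<in> {m..M} \<and> u \<noteq> w \<and> norm n = 1}"

definition Lu_ratios :: "real \<Rightarrow> real \<Rightarrow> (real \<Rightarrow> real) \<Rightarrow> real set" where
  "Lu_ratios m M \<theta> = {deriv (deriv \<theta>) u * (u - w) / (deriv \<theta> u - deriv \<theta> w) | u w.
     u \<in> {m..M} \<and> w \<in> {m..M} \<and> u \<noteq> w}"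

text \<open>The entropy flux is a primitive of \<open>\<eta>' f'\<close>. A locally Lipschitz \<open>f\<close> is differentiable almost
  everywhere and the value of the integral does not depend on the exceptional null set.\<close>

definition entropy_pair :: "(real \<Rightarrow> real^2) \<Rightarrow> (real \<Rightarrow> real) \<Rightarrow> (real \<Rightarrow> real^2) \<Rightarrow> bool" where
  "entropy_pair f \<eta> q \<longleftrightarrow> convex_on UNIV \<eta> \<and> (\<forall>u. \<eta> field_differentiable at u) \<and>
     (\<forall>a b. a \<le> b \<longrightarrow>
        ((\<lambda>w. deriv \<eta> w *\<^sub>R vector_derivative f (at w)) has_integral (q b - q a)) {a..b})"

definition entropy_potential ::
    "(real \<Rightarrow> real^2) \<Rightarrow> (real \<Rightarrow> real) \<Rightarrow> (real \<Rightarrow> real^2) \<Rightarrow> real \<Rightarrow> real^2" where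
  "entropy_potential f \<theta> g u = deriv \<theta> u *\<^sub>R f u - g u"

text \<open>Of the smoothness of the flux, only continuous differentiability in the two states is required.\<close>

definition ec_flux :: "(real \<Rightarrow> real^2) \<Rightarrow> (real \<Rightarrow> real) \<Rightarrow> (real \<Rightarrow> real^2) \<Rightarrow>
    (real \<Rightarrow> real \<Rightarrow> real^2 \<Rightarrow> real) \<Rightarrow> bool" where
  "ec_flux f \<theta> g hec \<longleftrightarrow>
     (\<forall>n. \<exists>h' :: real \<times> real \<Rightarrow> (real \<times> real) \<Rightarrow>\<^sub>L real. continuous_on UNIV h' \<and>
        (\<forall>z. ((\<lambda>(u, w). hec u w n) has_derivative h' z) (at z))) \<and>
     (\<forall>u n. hec u u n = f u \<bullet> n) \<and>
     (\<forall>u w n. hec u w n = hec w u n) \<and>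
     (\<forall>u w. linear (hec u w)) \<and>
     (\<forall>u w n. (deriv \<theta> w - deriv \<theta> u) * hec u w n =
        (entropy_potential f \<theta> g w - entropy_potential f \<theta> g u) \<bullet> n)"

text \<open>The conditions on the numerical fluxes concern states in \<open>[m,M]\<close> and unit normals only. The
  requirement \<open>\<alpha> \<ge> L_flux m M f\<close> includes \<open>\<alpha> > 0\<close>, so that the division by \<open>2 \<alpha>\<close> makes sense.\<close>

definition interface_flux ::
    "real \<Rightarrow> real \<Rightarrow> (real \<Rightarrow> real^2) \<Rightarrow> (real \<Rightarrow> real \<Rightarrow> real^2 \<Rightarrow> real) \<Rightarrow> bool" where
  "interface_flux m M f h \<longleftrightarrow>
     (\<exists>L1 L2. L1 + L2 \<ge> L_flux m M f \<and>
        (\<forall>w\<in>{m..M}. \<forall>n. norm n = 1 \<longrightarrow>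
           L1-lipschitz_on {m..M} (\<lambda>u. h u w n) \<and> L2-lipschitz_on {m..M} (\<lambda>u. h w u n))) \<and>
     (\<forall>u\<in>{m..M}. \<forall>n. norm n = 1 \<longrightarrow> h u u n = f u \<bullet> n) \<and>
     (\<forall>u\<in>{m..M}. \<forall>w\<in>{m..M}. \<forall>n. norm n = 1 \<longrightarrow> h u w n = - h w u (- n)) \<and>
     (\<forall>w\<in>{m..M}. \<forall>n. norm n = 1 \<longrightarrow>
        mono_on {m..M} (\<lambda>u. h u w n) \<and> antimono_on {m..M} (\<lambda>u. h w u n)) \<and>
     (\<forall>um\<in>{m..M}. \<forall>u\<in>{m..M}. \<forall>up\<in>{m..M}. \<forall>n \<alpha>. norm n = 1 \<and> 0 < \<alpha> \<and> L_flux m M f \<le> \<alpha> \<longrightarrow>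
        u - (h u up n - h um u n) / (2 * \<alpha>) \<in> {m..M})"

definition numerical_entropy_flux :: "real \<Rightarrow> real \<Rightarrow> (real \<Rightarrow> real^2) \<Rightarrow>
    (real \<Rightarrow> real \<Rightarrow> real^2 \<Rightarrow> real) \<Rightarrow> (real \<Rightarrow> real) \<Rightarrow> (real \<Rightarrow> real^2) \<Rightarrow>
    (real \<Rightarrow> real \<Rightarrow> real^2 \<Rightarrow> real) \<Rightarrow> bool" where
  "numerical_entropy_flux m M f h \<eta> q Q \<longleftrightarrow>
     (\<forall>u\<in>{m..M}. \<forall>n. norm n = 1 \<longrightarrow> Q u u n = q u \<bullet> n) \<and>
     (\<forall>u\<in>{m..M}. \<forall>w\<in>{m..M}. \<forall>n. norm n = 1 \<longrightarrow> Q u w n = - Q w u (- n)) \<and>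
     (\<forall>um\<in>{m..M}. \<forall>u\<in>{m..M}. \<forall>up\<in>{m..M}. \<forall>n \<alpha>. norm n = 1 \<and> 0 < \<alpha> \<and> L_flux m M f \<le> \<alpha> \<longrightarrow>
        \<eta> (u - (h u up n - h um u n) / (2 * \<alpha>)) \<le> \<eta> u - (Q u up n - Q um u n) / (2 * \<alpha>))"

definition U_ec :: "(real \<Rightarrow> real) \<Rightarrow> real \<Rightarrow> real \<Rightarrow> real" where
  "U_ec \<theta> um up =
     integral {0..1} (\<lambda>s. inv (deriv \<theta>) (s * deriv \<theta> up + (1 - s) * deriv \<theta> um))"


section \<open>The scheme\<close>

definition R_op :: "mesh \<Rightarrow> (real \<Rightarrow> real^2) \<Rightarrow> (real \<Rightarrow> real \<Rightarrow> real^2 \<Rightarrow> real) \<Rightarrow>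
    (real \<Rightarrow> real \<Rightarrow> real^2 \<Rightarrow> real) \<Rightarrow> ((real^2) set \<Rightarrow> nat \<Rightarrow> nat \<Rightarrow> real) \<Rightarrow>
    (real^2) set \<Rightarrow> nat \<Rightarrow> nat \<Rightarrow> real" where
  "R_op G f hec h W \<kappa> i j =
     2 * (wt (sp G) j * (\<Sum>k\<le>degr (sp G). Qmat (sp G) i k * hec (W \<kappa> i j) (W \<kappa> k j) (n_xi G \<kappa> i k j))
        + wt (sp G) i * (\<Sum>k\<le>degr (sp G). Qmat (sp G) j k * hec (W \<kappa> i j) (W \<kappa> i k) (n_zeta G \<kappa> i j k)))
     + (\<Sum>e\<in>edges G \<kappa>. \<Sum>k\<le>degr (sp G). phi G \<kappa> i j (xe G e k) * wt (sp G) k * Je G e k *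
         (h (W \<kappa> i j) (u_space G W (neighbour G \<kappa> e) (xe G e k)) (nrm G \<kappa> e k)
          - f (W \<kappa> i j) \<bullet> nrm G \<kappa> e k))"

definition V_op :: "mesh \<Rightarrow> ((real^2) set \<Rightarrow> real) \<Rightarrow> ((real^2) set \<Rightarrow> nat \<Rightarrow> nat \<Rightarrow> real) \<Rightarrow>
    (real^2) set \<Rightarrow> nat \<Rightarrow> nat \<Rightarrow> real" where
  "V_op G dk W \<kappa> i j = dk \<kappa> * wt (sp G) i * wt (sp G) j * (\<Sum>k\<le>degr (sp G).
       wt (sp G) k / 2 * norm (n_xi G \<kappa> i k j) * (W \<kappa> i j - W \<kappa> k j)
     + wt (sp G) k / 2 * norm (n_zeta G \<kappa> i j k) * (W \<kappa> i j - W \<kappa> i k))"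

text \<open>\<open>y r\<close> is the value at the time node \<open>r\<close> of the slab and \<open>y0\<close> the one at the end of the previous
  slab.\<close>

definition T_op :: "quad \<Rightarrow> (real \<Rightarrow> real) \<Rightarrow> real \<Rightarrow> (nat \<Rightarrow> real) \<Rightarrow> real \<Rightarrow> nat \<Rightarrow> real" where
  "T_op T \<theta> d y y0 r = (\<Sum>m\<le>degr T. 2 * Qmat T r m * U_ec \<theta> (y r) (y m))
     + (if r = 0 then y 0 - y0 else 0)
     + d * wt T r * (\<Sum>m\<le>degr T. wt T m * (y r - y m))"

end

theory Submission
  imports Defs
begin

text \<open>
  Multiplying the scheme by \<open>\<eta>'\<close> of the degrees of freedom and summing over the nodes of an element and
  of the time slab, summation by parts turns the volume terms in space and time into boundary terms
  plus pairwise contributions \<open>\<omega>\<^sub>i D\<^sub>i\<^sub>k\<close> times \<open>(\<eta>'\<^sub>i - \<eta>'\<^sub>k) H\<^sub>i\<^sub>k - (\<Psi>\<^sub>i - \<Psi>\<^sub>k)\<close>, where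
  \<open>\<Psi>\<close> is a potential with \<open>\<Psi>' = \<eta>'' f\<close> (in time, with the identity for \<open>f\<close>). An entropy conservative flux \<open>H\<^sub>i\<^sub>k\<close> is a mean
  value of \<open>f\<close> between the two states, so such a contribution is at most \<open>L\<^sub>f (\<eta>'\<^sub>i - \<eta>'\<^sub>k) (u\<^sub>i - u\<^sub>k)\<close>
  (times the norm of the normal) in absolute value, and the graph viscosity absorbs it since
  \<open>L\<^sub>u \<ge> 1\<close>. The metric identities cancel the remaining interior terms, and the entropy
  inequality of the interface flux with \<open>u\<^sup>- = u\<close> bounds the face terms by \<open>Q\<close>.
\<close>

section \<open>Summation by parts for Gauss-Lobatto rules\<close>

lemma gauss_lobatto_degr_pos:
  assumes "gauss_lobatto S"
  shows "1 \<le> degr S"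
  using assms by (cases "degr S") (auto simp: gauss_lobatto_def)

lemma gauss_lobatto_wt_pos:
  assumes "gauss_lobatto S" and "k \<le> degr S"
  shows "0 < wt S k"
  using assms by (simp add: gauss_lobatto_def)

lemma gauss_lobatto_pt_less:
  assumes S: "gauss_lobatto S" and "k < l" and "l \<le> degr S"
  shows "pt S k < pt S l"
  using \<open>k < l\<close> \<open>l \<le> degr S\<close>
proof (induction l)
  case (Suc l)
  then have "pt S l < pt S (Suc l)"
    using S by (simp add: gauss_lobatto_def)
  then show ?case
    using Suc by (cases "k = l") auto
qed simp

lemma gauss_lobatto_pt_eq_iff:
  assumes "gauss_lobatto S" "k \<le> degr S" "l \<le> degr S"
  shows "pt S k = pt S l \<longleftrightarrow> k = l"
  using gauss_lobatto_pt_less[OF assms(1), of k l] gauss_lobatto_pt_less[OF assms(1), of l k] assms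
  by (cases k l rule: linorder_cases) auto

lemma gauss_lobatto_pt_inj:
  assumes "gauss_lobatto S"
  shows "inj_on (pt S) {..degr S}"
  using gauss_lobatto_pt_eq_iff[OF assms] by (auto simp: inj_on_def)

lemma gauss_lobatto_pt_bounds:
  assumes S: "gauss_lobatto S" and k: "k \<le> degr S"
  shows "pt S k \<in> {-1..1}"
proof -
  have "pt S 0 \<le> pt S k"
    using gauss_lobatto_pt_less[OF S, of 0 k] k by (cases "k = 0") auto
  moreover have "pt S k \<le> pt S (degr S)"
    using gauss_lobatto_pt_less[OF S, of k "degr S"] k by (cases "k = degr S") auto
  ultimately show ?thesis
    using S by (simp add: gauss_lobatto_def)
qed

lemma gauss_lobatto_exact:
  assumes "gauss_lobatto S" and "degree P \<le> 2 * degr S - 1"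
  shows "(poly P has_integral (\<Sum>k\<le>degr S. wt S k * poly P (pt S k))) {-1..1}"
  using assms by (simp add: gauss_lobatto_def)

section \<open>Nodal basis and differentiation matrix\<close>

lemma poly_lag:
  assumes "gauss_lobatto S" "k \<le> degr S" "l \<le> degr S"
  shows "poly (lag S k) (pt S l) = (if k = l then 1 else 0)"
proof (cases "k = l")
  case True
  have "(\<Prod>i\<in>{..degr S} - {k}. 1 / (pt S k - pt S i) * (pt S k - pt S i)) = 1"
    using assms by (intro prod.neutral) (auto simp: gauss_lobatto_pt_eq_iff)
  moreover have "1 / (pt S k - pt S i) * (pt S k - pt S i) =
      poly (smult (1 / (pt S k - pt S i)) [:- pt S i, 1:]) (pt S k)" for i
    by (simp add: algebra_simps diff_divide_distrib[symmetric])
  ultimately show ?thesis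
    using True by (simp add: lag_def poly_prod del: poly_smult)
next
  case False
  then have "l \<in> {..degr S} - {k}" "poly (smult (1 / (pt S k - pt S l)) [:- pt S l, 1:]) (pt S l) = 0"
    using assms by auto
  then show ?thesis
    using False by (auto simp: lag_def poly_prod intro!: prod_zero)
qed

lemma degree_lag:
  assumes "k \<le> degr S"
  shows "degree (lag S k) \<le> degr S"
proof -
  have "degree (lag S k) \<le> (\<Sum>l\<in>{..degr S} - {k}. degree (smult (1 / (pt S k - pt S l)) [:- pt S l, 1:]))"
    unfolding lag_def by (rule degree_prod_sum_le[unfolded o_def]) simp
  also have "\<dots> \<le> (\<Sum>l\<in>{..degr S} - {k}. 1)"
    by (intro sum_mono order_trans[OF degree_smult_le]) simp
  finally show ?thesis
    using assms by simp
qed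

text \<open>The difference from \<open>1\<close> has degree at most \<open>degr S\<close> but
  vanishes at all \<open>degr S + 1\<close> nodes.\<close>

lemma sum_lag:
  assumes S: "gauss_lobatto S"
  shows "(\<Sum>k\<le>degr S. lag S k) = 1"
proof (rule ccontr)
  let ?P = "(\<Sum>k\<le>degr S. lag S k) - 1"
  assume "(\<Sum>k\<le>degr S. lag S k) \<noteq> 1"
  then have "?P \<noteq> 0" by simp
  have "degree ?P \<le> degr S"
    by (intro degree_diff_le degree_sum_le) (auto simp: degree_lag)
  moreover have "pt S ` {..degr S} \<subseteq> {x. poly ?P x = 0}"
    using S by (auto simp: poly_sum poly_lag)
  then have "card (pt S ` {..degr S}) \<le> card {x. poly ?P x = 0}"
    using poly_roots_finite[OF \<open>?P \<noteq> 0\<close>] by (rule card_mono[rotated])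
  ultimately show False
    using card_poly_roots_bound[OF \<open>?P \<noteq> 0\<close>] gauss_lobatto_pt_inj[OF S]
    by (simp add: card_image)
qed

text \<open>Differentiates the partition of unity \<open>sum_lag\<close>. In time this removes the
  volume contribution of the potential.\<close>

lemma sum_Dmat:
  assumes S: "gauss_lobatto S"
  shows "(\<Sum>l\<le>degr S. Dmat S k l) = 0"
proof -
  have "(\<Sum>l\<le>degr S. Dmat S k l) = poly (pderiv (\<Sum>l\<le>degr S. lag S l)) (pt S k)"
    by (simp add: Dmat_def poly_sum higher_pderiv_sum[of 1, simplified])
  then show ?thesis
    by (simp add: sum_lag[OF S])
qed

text \<open>Discrete integration by parts: the derivative of \<open>lag S k * lag S l\<close> has
  degree at most \<open>2 * degr S - 1\<close>, so the quadrature evaluates its integral exactly,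
  and the fundamental theorem of calculus reduces that integral to values at the end points.\<close>

lemma Qmat_sbp:
  assumes S: "gauss_lobatto S" and k: "k \<le> degr S" and l: "l \<le> degr S"
  shows "Qmat S k l + Qmat S l k =
    (if k = l \<and> k = degr S then 1 else 0) - (if k = l \<and> k = 0 then 1 else 0)"
proof -
  let ?P = "lag S k * lag S l"
  have "degree (pderiv ?P) \<le> 2 * degr S - 1"
    using degree_mult_le[of "lag S k" "lag S l"] degree_lag[OF k] degree_lag[OF l]
    by (simp add: degree_pderiv)
  from gauss_lobatto_exact[OF S this]
  have "(poly (pderiv ?P) has_integral
      (\<Sum>i\<le>degr S. wt S i * poly (pderiv ?P) (pt S i))) {-1..1}" .
  moreover have "(poly (pderiv ?P) has_integral poly ?P 1 - poly ?P (-1)) {-1..1}"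
    by (rule fundamental_theorem_of_calculus)
      (auto simp del: poly_mult simp: has_real_derivative_iff_has_vector_derivative[symmetric]
        intro: DERIV_subset[OF poly_DERIV])
  ultimately have "(\<Sum>i\<le>degr S. wt S i * poly (pderiv ?P) (pt S i)) = poly ?P 1 - poly ?P (-1)"
    by (rule has_integral_unique)
  moreover have "(\<Sum>i\<le>degr S. wt S i * poly (pderiv ?P) (pt S i)) = Qmat S k l + Qmat S l k"
  proof -
    have "wt S i * poly (pderiv ?P) (pt S i) =
        (if i = k then Qmat S i l else 0) + (if i = l then Qmat S i k else 0)"
      if "i \<le> degr S" for i
      using poly_lag[OF S k that] poly_lag[OF S l that]
      by (auto simp: pderiv_mult Qmat_def Dmat_def algebra_simps)
    then have "(\<Sum>i\<le>degr S. wt S i * poly (pderiv ?P) (pt S i)) =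
        (\<Sum>i\<le>degr S. (if i = k then Qmat S i l else 0) + (if i = l then Qmat S i k else 0))"
      by simp
    then show ?thesis
      using k l by (simp add: sum.distrib)
  qed
  moreover have "poly ?P 1 = (if k = l \<and> k = degr S then 1 else 0)"
    using poly_lag[OF S k, of "degr S"] poly_lag[OF S l, of "degr S"] S
    by (auto simp: gauss_lobatto_def)
  moreover have "poly ?P (-1) = (if k = l \<and> k = 0 then 1 else 0)"
    using poly_lag[OF S k, of 0] poly_lag[OF S l, of 0] S
    by (auto simp: gauss_lobatto_def)
  ultimately show ?thesis by simp
qed

text \<open>Exchanging the arguments of \<open>X\<close> amounts to transposing \<open>Qmat\<close>,
  which costs a sign and two boundary entries.\<close>

lemma sum_Qmat_transpose:
  fixes X :: "nat \<Rightarrow> nat \<Rightarrow> real"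
  assumes S: "gauss_lobatto S"
  defines "s \<equiv> degr S"
  shows "(\<Sum>i\<le>s. \<Sum>k\<le>s. Qmat S i k * X k i) =
    X s s - X 0 0 - (\<Sum>i\<le>s. \<Sum>k\<le>s. Qmat S i k * X i k)"
proof -
  have "(\<Sum>i\<le>s. \<Sum>k\<le>s. Qmat S i k * X k i) + (\<Sum>i\<le>s. \<Sum>k\<le>s. Qmat S i k * X i k)
      = (\<Sum>i\<le>s. \<Sum>k\<le>s. (Qmat S i k + Qmat S k i) * X i k)"
    by (subst sum.swap) (simp add: sum.distrib[symmetric] algebra_simps)
  also have "\<dots> = (\<Sum>i\<le>s. \<Sum>k\<le>s. (if k = i then (if i = s then X i i else 0) - (if i = 0 then X i i else 0) else 0))"
    using Qmat_sbp[OF S] unfolding s_def by (intro sum.cong refl) auto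
  also have "\<dots> = (\<Sum>i\<le>s. (if i = s then X i i else 0) - (if i = 0 then X i i else 0))"
    by simp
  also have "\<dots> = X s s - X 0 0"
    by (simp add: sum_subtractf)
  finally show ?thesis by linarith
qed

lemma abs_Dmat_le_max_D:
  assumes S: "gauss_lobatto S" and "k \<le> degr S" "l \<le> degr S" "k \<noteq> l"
  shows "\<bar>Dmat S k l\<bar> \<le> max_D S * wt S l"
proof -
  let ?A = "{\<bar>Dmat S k l\<bar> / wt S l | k l. k \<le> degr S \<and> l \<le> degr S \<and> k \<noteq> l}"
  have "?A \<subseteq> (\<lambda>(k, l). \<bar>Dmat S k l\<bar> / wt S l) ` ({..degr S} \<times> {..degr S})"
    by auto
  then have "finite ?A"
    by (rule finite_subset) simp
  then have "\<bar>Dmat S k l\<bar> / wt S l \<le> max_D S"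
    unfolding max_D_def using assms by (intro Max_ge) auto
  then show ?thesis
    using gauss_lobatto_wt_pos[OF S] assms by (simp add: divide_le_eq)
qed

text \<open>The one-dimensional core, used along each grid line of an element and in time. Here
  \<open>a\<close> holds the values of \<open>deriv \<eta>\<close>, \<open>H\<close> the two-point
  flux, \<open>X\<close> the potential and \<open>c\<close> the viscosity coefficients. In space
  \<open>X i k\<close> pairs the potential at \<open>i\<close> with the normal of the pair, hence
  \<open>X\<close> has two indices and need not be symmetric.\<close>

lemma sbp_entropy_production:
  fixes a u :: "nat \<Rightarrow> real" and H X c :: "nat \<Rightarrow> nat \<Rightarrow> real"
  assumes S: "gauss_lobatto S"
    and H: "\<And>i k. H i k = H k i" and c: "\<And>i k. c i k = c k i"
    and dissipation: "\<And>i k. i \<le> degr S \<Longrightarrow> k \<le> degr S \<Longrightarrow>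
      \<bar>Dmat S i k\<bar> * \<bar>(a i - a k) * H i k - (X i k - X k i)\<bar>
        \<le> wt S k * (c i k * ((a i - a k) * (u i - u k)))"
  defines "s \<equiv> degr S"
  shows "2 * (\<Sum>i\<le>s. wt S i * (\<Sum>k\<le>s. Dmat S i k * X i k))
      + (a s * H s s - X s s) - (a 0 * H 0 0 - X 0 0)
    \<le> 2 * (\<Sum>i\<le>s. a i * (\<Sum>k\<le>s. Qmat S i k * H i k))
      + 2 * (\<Sum>i\<le>s. a i * (wt S i * (\<Sum>k\<le>s. wt S k * c i k * (u i - u k))))"
proof -
  define E where "E i k = (a i - a k) * H i k - (X i k - X k i)" for i k
  define V where "V i k = wt S i * wt S k * c i k" for i k
  \<comment> \<open>By symmetry of \<open>H\<close>, \<open>E i k\<close> is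
    \<open>a i * H i k - X i k\<close> minus the same expression with the indices exchanged;
    transposing \<open>Qmat\<close> then doubles the sum up to boundary terms.\<close>
  have "(\<Sum>i\<le>s. \<Sum>k\<le>s. Qmat S i k * E i k) =
      (\<Sum>i\<le>s. \<Sum>k\<le>s. Qmat S i k * (a i * H i k - X i k))
      - (\<Sum>i\<le>s. \<Sum>k\<le>s. Qmat S i k * (a k * H k i - X k i))"
    unfolding E_def sum_subtractf[symmetric]
  proof (intro sum.cong refl)
    fix i k
    show "Qmat S i k * ((a i - a k) * H i k - (X i k - X k i)) =
        Qmat S i k * (a i * H i k - X i k) - Qmat S i k * (a k * H k i - X k i)"
      unfolding H[of k i] by (simp add: algebra_simps)
  qed
  also have "\<dots> = 2 * (\<Sum>i\<le>s. \<Sum>k\<le>s. Qmat S i k * (a i * H i k - X i k))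
      - (a s * H s s - X s s) + (a 0 * H 0 0 - X 0 0)"
    using sum_Qmat_transpose[OF S, of "\<lambda>i k. a i * H i k - X i k"] by (simp add: s_def)
  also have "(\<Sum>i\<le>s. \<Sum>k\<le>s. Qmat S i k * (a i * H i k - X i k)) =
      (\<Sum>i\<le>s. a i * (\<Sum>k\<le>s. Qmat S i k * H i k)) - (\<Sum>i\<le>s. wt S i * (\<Sum>k\<le>s. Dmat S i k * X i k))"
    by (simp add: Qmat_def sum_distrib_left sum_subtractf[symmetric] algebra_simps)
  finally have E: "(\<Sum>i\<le>s. \<Sum>k\<le>s. Qmat S i k * E i k) =
      2 * (\<Sum>i\<le>s. a i * (\<Sum>k\<le>s. Qmat S i k * H i k)) - 2 * (\<Sum>i\<le>s. wt S i * (\<Sum>k\<le>s. Dmat S i k * X i k))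
      - (a s * H s s - X s s) + (a 0 * H 0 0 - X 0 0)" by simp
  \<comment> \<open>Since \<open>V\<close> is symmetric, exchanging the indices makes the half
    carrying \<open>a k\<close> the negative of the half carrying \<open>a i\<close>. Testing the
    viscosity with \<open>a\<close> thus yields half of the symmetric dissipation.\<close>
  have "(\<Sum>i\<le>s. \<Sum>k\<le>s. V i k * (a k * (u i - u k))) = (\<Sum>i\<le>s. \<Sum>k\<le>s. V k i * (a i * (u k - u i)))"
    by (rule sum.swap)
  also have "\<dots> = - (\<Sum>i\<le>s. \<Sum>k\<le>s. V i k * (a i * (u i - u k)))"
    unfolding sum_negf[symmetric] V_def by (intro sum.cong refl) (subst c, simp add: algebra_simps)
  finally have V: "(\<Sum>i\<le>s. \<Sum>k\<le>s. V i k * ((a i - a k) * (u i - u k))) =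
      2 * (\<Sum>i\<le>s. \<Sum>k\<le>s. V i k * (a i * (u i - u k)))"
    by (simp add: algebra_simps sum_subtractf sum.distrib)
  have "0 \<le> (\<Sum>i\<le>s. \<Sum>k\<le>s. Qmat S i k * E i k + V i k * ((a i - a k) * (u i - u k)))"
  proof (intro sum_nonneg)
    fix i k assume "i \<in> {..s}" "k \<in> {..s}"
    then have le: "i \<le> degr S" "k \<le> degr S" by (auto simp: s_def)
    \<comment> \<open>Whatever the sign of \<open>Dmat S i k * E i k\<close>, the assumed bound lets
      the viscosity outweigh it.\<close>
    have "0 \<le> Dmat S i k * E i k + wt S k * (c i k * ((a i - a k) * (u i - u k)))"
      using dissipation[OF le] abs_mult[of "Dmat S i k" "E i k"] unfolding E_def[symmetric] by linarith
    then have "0 \<le> wt S i * (Dmat S i k * E i k + wt S k * (c i k * ((a i - a k) * (u i - u k))))"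
      using gauss_lobatto_wt_pos[OF S le(1)] by simp
    then show "0 \<le> Qmat S i k * E i k + V i k * ((a i - a k) * (u i - u k))"
      by (simp add: Qmat_def V_def algebra_simps)
  qed
  then have "0 \<le> (\<Sum>i\<le>s. \<Sum>k\<le>s. Qmat S i k * E i k) + 2 * (\<Sum>i\<le>s. \<Sum>k\<le>s. V i k * (a i * (u i - u k)))"
    unfolding V[symmetric] by (simp add: sum.distrib)
  also have "(\<Sum>i\<le>s. \<Sum>k\<le>s. V i k * (a i * (u i - u k))) =
      (\<Sum>i\<le>s. a i * (wt S i * (\<Sum>k\<le>s. wt S k * c i k * (u i - u k))))"
    by (simp add: V_def sum_distrib_left algebra_simps)
  finally show ?thesis
    unfolding E by linarith
qed

section \<open>Entropy production of two-point fluxes\<close>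

lemma strict_mono_deriv_pos:
  fixes v v' :: "real \<Rightarrow> real"
  assumes "\<And>x. (v has_real_derivative v' x) (at x)" and "\<And>x. 0 < v' x"
  shows "strict_mono v"
  by (rule strict_monoI) (meson assms DERIV_pos_imp_increasing)

text \<open>Rolle's theorem with end points in either order, as the two states of a flux come
  unordered.\<close>

lemma rolle_closed_segment:
  fixes F F' :: "real \<Rightarrow> real"
  assumes "\<And>z. (F has_real_derivative F' z) (at z)" and "F x = F y" and "x \<noteq> y"
  obtains \<xi> where "\<xi> \<in> closed_segment x y" and "F' \<xi> = 0"
proof -
  have *: "\<exists>\<xi>. \<xi> \<in> closed_segment a b \<and> F' \<xi> = 0" if "a < b" "F a = F b" for a b
  proof -
    obtain z where "a < z" "z < b" "F b - F a = (b - a) * F' z"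
      using MVT2[OF \<open>a < b\<close> assms(1)] by blast
    then show ?thesis
      using that by (intro exI[of _ z]) (auto simp: closed_segment_eq_real_ivl)
  qed
  show ?thesis
  proof (cases "x < y")
    case True
    then show ?thesis using * assms(2) that by blast
  next
    case False
    then have "y < x" using assms(3) by simp
    then show ?thesis using *[of y x] assms(2) that by (metis closed_segment_commute)
  qed
qed

text \<open>Inside the absolute value stands, in essence, the integral of
  \<open>A' w * (c - \<phi> w)\<close> between the two states. In the applications \<open>A\<close>
  is \<open>deriv \<eta>\<close>, \<open>P\<close> the potential and \<open>c\<close> a two-point
  flux close to \<open>\<phi>\<close>. Monotonicity replaces integration, since \<open>A'\<close>
  may be discontinuous.\<close>

lemma entropy_production_bound:
  fixes A A' P \<phi> :: "real \<Rightarrow> real"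
  assumes A: "\<And>z. (A has_real_derivative A' z) (at z)" "\<And>z. 0 \<le> A' z"
    and P: "\<And>z. (P has_real_derivative A' z * \<phi> z) (at z)"
    and bound: "\<And>w. w \<in> closed_segment x y \<Longrightarrow> \<bar>c - \<phi> w\<bar> \<le> C * \<bar>x - y\<bar>"
  shows "\<bar>(A x - A y) * c - (P x - P y)\<bar> \<le> C * ((A x - A y) * (x - y))"
proof -
  have main: "\<bar>(A a - A b) * c - (P a - P b)\<bar> \<le> C * ((A a - A b) * (a - b))"
    if "a \<le> b" and bound: "\<And>w. w \<in> {a..b} \<Longrightarrow> \<bar>c - \<phi> w\<bar> \<le> C * \<bar>a - b\<bar>" for a b
  proof -
    \<comment> \<open>The signs \<open>s = 1\<close> and \<open>s = -1\<close> give the two halves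
      of the absolute value. The derivative of \<open>F s\<close> is
      \<open>A' w * (C * (b - a) + s * (c - \<phi> w))\<close>, which is nonnegative.\<close>
    define F where "F s w = C * (b - a) * A w + s * (c * A w - P w)" for s w
    have "F s a \<le> F s b" if s: "\<bar>s\<bar> = 1" for s
    proof (rule DERIV_nonneg_imp_nondecreasing[OF \<open>a \<le> b\<close>])
      fix w assume w: "a \<le> w" "w \<le> b"
      have "(F s has_real_derivative A' w * (C * (b - a) + s * (c - \<phi> w))) (at w)"
        unfolding F_def by (auto intro!: derivative_eq_intros A P simp: algebra_simps)
      moreover have "\<bar>s * (c - \<phi> w)\<bar> \<le> C * (b - a)"
        using bound[of w] w \<open>a \<le> b\<close> s by (simp add: abs_mult abs_minus_commute)
      then have "0 \<le> A' w * (C * (b - a) + s * (c - \<phi> w))"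
        using A(2)[of w] by (intro mult_nonneg_nonneg) (auto simp: abs_le_iff)
      ultimately show "\<exists>y. (F s has_real_derivative y) (at w) \<and> 0 \<le> y" by blast
    qed
    from this[of 1] this[of "-1"] show ?thesis
      by (simp add: F_def abs_le_iff algebra_simps)
  qed
  show ?thesis
  proof (cases "x \<le> y")
    case True
    then show ?thesis
      using bound by (intro main) (auto simp: closed_segment_eq_real_ivl)
  next
    case False
    then have "\<bar>(A y - A x) * c - (P y - P x)\<bar> \<le> C * ((A y - A x) * (y - x))"
      using bound by (intro main) (auto simp: closed_segment_eq_real_ivl abs_minus_commute)
    then show ?thesis
      by (simp add: algebra_simps abs_minus_commute abs_le_iff)
  qed
qed

lemma convex_on_tangent:
  fixes \<eta> :: "real \<Rightarrow> real"
  assumes "convex_on UNIV \<eta>" and "\<eta> field_differentiable at u"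
  shows "\<eta> u + deriv \<eta> u * (w - u) \<le> \<eta> w"
proof -
  have "(\<eta> has_real_derivative deriv \<eta> u) (at u)"
    using assms(2) by (simp add: field_differentiable_derivI)
  then show ?thesis
    using convex_on_imp_above_tangent[OF assms(1), of u w "deriv \<eta> u"] by simp
qed

text \<open>In time the identity plays the part of the flux, and this is the potential that belongs
  to it.\<close>

lemma time_potential_derivative:
  fixes \<eta> :: "real \<Rightarrow> real"
  assumes "\<eta> field_differentiable at u" "deriv \<eta> field_differentiable at u"
  shows "((\<lambda>u. deriv \<eta> u * u - \<eta> u) has_real_derivative deriv (deriv \<eta>) u * u) (at u)"
  using assms[THEN field_differentiable_derivI]
  by (auto intro!: derivative_eq_intros simp: algebra_simps)

text \<open>Substitution of \<open>1 - s\<close> for \<open>s\<close>, carried out as a shift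
  followed by a reflection.\<close>

lemma U_ec_commute: "U_ec \<theta> a b = U_ec \<theta> b a"
proof -
  let ?F = "\<lambda>s. inv (deriv \<theta>) (s * deriv \<theta> b + (1 - s) * deriv \<theta> a)"
  have "integral {0..1} (\<lambda>s. ?F (1 - s)) = integral {-1..0} (\<lambda>s. ?F (1 - (s + 1)))"
    using integral_shift_real_ivl[of 0 1 1 "\<lambda>s. ?F (1 - s)"] by (simp only: diff_self diff_0)
  also have "\<dots> = integral {-1..- 0} (\<lambda>s. ?F (- s))"
    by (simp only: diff_add_eq_diff_diff_swap diff_self diff_0 minus_zero)
  also have "\<dots> = integral {0..1} ?F"
    by (rule Henstock_Kurzweil_Integration.integral_reflect_real)
  finally have "integral {0..1} (\<lambda>s. ?F (1 - s)) = integral {0..1} ?F" .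
  then show ?thesis
    by (simp add: U_ec_def algebra_simps)
qed

text \<open>\<open>U_ec\<close> averages the inverse of the increasing function
  \<open>deriv \<theta>\<close> over the segment from \<open>deriv \<theta> a\<close> to
  \<open>deriv \<theta> b\<close>, hence averages states between \<open>a\<close> and
  \<open>b\<close>.\<close>

lemma U_ec_bounds:
  assumes v: "\<And>x. deriv \<theta> field_differentiable at x" "\<And>x. 0 < deriv (deriv \<theta>) x"
  shows "U_ec \<theta> a b \<in> closed_segment a b"
proof -
  let ?v = "deriv \<theta>"
  let ?l = "\<lambda>s. s * ?v b + (1 - s) * ?v a"
  have D: "(?v has_real_derivative deriv ?v x) (at x)" for x
    using v(1) by (simp add: field_differentiable_derivI)
  have mono: "strict_mono ?v"
    using strict_mono_deriv_pos[OF D v(2)] .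
  then have inv: "inv ?v (?v x) = x" for x
    by (simp add: strict_mono_imp_inj_on)
  have cont: "continuous_on S ?v" for S
    by (meson D DERIV_continuous_on has_field_derivative_at_within)
  let ?lo = "min a b" and ?hi = "max a b"
  \<comment> \<open>\<open>deriv \<theta>\<close> need not be onto, and \<open>inv\<close> is
    meaningful only on its range. The intermediate value theorem places every convex combination
    there, even in the image of the segment between the two states.\<close>
  have img: "?l s \<in> ?v ` {?lo..?hi}" if s: "s \<in> {0..1}" for s
  proof -
    have le: "?v ?lo \<le> ?v x" "?v x \<le> ?v ?hi" if "x \<in> {a, b}" for x
      using that mono by (auto simp: strict_mono_less_eq)
    have "?l s \<in> {?v ?lo..?v ?hi}"
      using le[of a] le[of b] s convex_bound_le[of "?v b" "?v ?hi" "?v a" s "1 - s"]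
        convex_bound_le[of "- ?v b" "- ?v ?lo" "- ?v a" s "1 - s"] by auto
    then have le: "?v ?lo \<le> ?l s" "?l s \<le> ?v ?hi"
      by (simp_all only: atLeastAtMost_iff)
    have "?lo \<le> ?hi" by simp
    from IVT'[OF le this cont] obtain x where x: "?lo \<le> x" "x \<le> ?hi" "?v x = ?l s"
      by blast
    show ?thesis
      unfolding x(3)[symmetric] using x(1,2) by (intro imageI) (simp only: atLeastAtMost_iff)
  qed
  have "continuous_on (?v ` {?lo..?hi}) (inv ?v)"
    by (rule continuous_on_inv[OF cont]) (auto simp: inv)
  then have "continuous_on {0..1} (\<lambda>s. inv ?v (?l s))"
    by (rule continuous_on_compose2) (use img in \<open>auto intro!: continuous_intros\<close>)
  then have int: "((\<lambda>s. inv ?v (?l s)) has_integral U_ec \<theta> a b) {0..1}"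
    unfolding U_ec_def by (intro integrable_integral integrable_continuous_real)
  have *: "?lo \<le> inv ?v (?l s)" "inv ?v (?l s) \<le> ?hi" if s: "s \<in> {0..1}" for s
  proof -
    obtain x where x: "x \<in> {?lo..?hi}" "?l s = ?v x"
      using img[OF s] by (rule imageE)
    then show "?lo \<le> inv ?v (?l s)" "inv ?v (?l s) \<le> ?hi"
      unfolding x(2) inv by (simp_all only: atLeastAtMost_iff)
  qed
  have "measure lborel {0..1::real} *\<^sub>R ?lo \<le> U_ec \<theta> a b"
    by (rule has_integral_le[OF has_integral_const_real int *(1)])
  moreover have "U_ec \<theta> a b \<le> measure lborel {0..1::real} *\<^sub>R ?hi"
    by (rule has_integral_le[OF int has_integral_const_real *(2)])
  ultimately show ?thesis
    by (auto simp: closed_segment_eq_real_ivl)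
qed

lemma U_ec_same:
  assumes "\<And>x. deriv \<theta> field_differentiable at x" "\<And>x. 0 < deriv (deriv \<theta>) x"
  shows "U_ec \<theta> a a = a"
  using U_ec_bounds[OF assms, of a a] by simp

text \<open>With one state fixed at \<open>m\<close> and the other tending to \<open>m\<close> from
  above, the ratios tend to \<open>1\<close>. For \<open>m = M\<close> there are no ratios at all,
  hence the strict inequality.\<close>

lemma Sup_Lu_ratios_ge_1:
  assumes v: "\<And>x. deriv \<theta> field_differentiable at x" "\<And>x. 0 < deriv (deriv \<theta>) x"
    and bdd: "bdd_above (Lu_ratios m M \<theta>)" and "m < M"
  shows "1 \<le> Sup (Lu_ratios m M \<theta>)"
proof -
  let ?v = "deriv \<theta>"
  have D: "(?v has_real_derivative deriv ?v x) (at x)" for x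
    using v(1) by (simp add: field_differentiable_derivI)
  have "((\<lambda>w. (?v w - ?v m) / (w - m)) \<longlongrightarrow> deriv ?v m) (at m within {m<..<M})"
    using has_field_derivative_at_within[OF D[of m], of "{m<..<M}"] by (simp add: has_field_derivative_iff)
  then have "((\<lambda>w. deriv ?v m / ((?v w - ?v m) / (w - m))) \<longlongrightarrow> deriv ?v m / deriv ?v m) (at m within {m<..<M})"
    using v(2)[of m] by (intro tendsto_intros) auto
  moreover have "deriv ?v m / deriv ?v m = 1" using v(2)[of m] by simp
  ultimately have lim: "((\<lambda>w. deriv ?v m / ((?v w - ?v m) / (w - m))) \<longlongrightarrow> 1) (at m within {m<..<M})"
    by simp
  have "deriv ?v m / ((?v w - ?v m) / (w - m)) \<le> Sup (Lu_ratios m M \<theta>)" if "w \<in> {m<..<M}" for w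
  proof (rule cSup_upper[OF _ bdd])
    have "deriv ?v m / ((?v w - ?v m) / (w - m)) = deriv ?v m * - (w - m) / - (?v w - ?v m)"
      by (simp only: mult_minus_right minus_divide_divide divide_divide_eq_right)
    then have "deriv ?v m / ((?v w - ?v m) / (w - m)) = deriv ?v m * (m - w) / (?v m - ?v w)"
      by (simp only: minus_diff_eq)
    then show "deriv ?v m / ((?v w - ?v m) / (w - m)) \<in> Lu_ratios m M \<theta>"
      using that \<open>m < M\<close> unfolding Lu_ratios_def by force
  qed
  moreover have "at m within {m<..<M} \<noteq> bot"
    using \<open>m < M\<close> by (simp add: trivial_limit_within islimpt_greaterThanLessThan1)
  ultimately show ?thesis
    by (intro tendsto_upperbound[OF lim]) (auto simp: eventually_at_filter)
qed

section \<open>Flux estimates\<close>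

text \<open>Since \<open>f u \<bullet> n\<close> is the diagonal of \<open>hec\<close>, the flux inherits its smoothness; in particular the
  entropy fluxes are classical primitives.\<close>

lemma ec_flux_imp_C1:
  assumes "ec_flux f \<theta> g hec"
  obtains f' where "\<And>u. (f has_vector_derivative f' u) (at u)" and "continuous_on UNIV f'"
proof -
  have "\<exists>d. continuous_on UNIV d \<and> (\<forall>u. ((\<lambda>u. f u \<bullet> n) has_real_derivative d u) (at u))" for n
  proof -
    obtain h' :: "real \<times> real \<Rightarrow> (real \<times> real) \<Rightarrow>\<^sub>L real" where h': "continuous_on UNIV (\<lambda>z. blinfun_apply (h' z))"
      "\<And>z. ((\<lambda>(u, w). hec u w n) has_derivative h' z) (at z)"
      using assms[unfolded ec_flux_def, THEN conjunct1, THEN spec[of _ n]] by (elim exE conjE) blast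
    have "((\<lambda>u. f u \<bullet> n) has_real_derivative h' (u, u) (1, 1)) (at u)" for u
    proof -
      have "((\<lambda>u. (u, u)) has_derivative (\<lambda>x. (x, x))) (at u)"
        by (intro derivative_intros)
      from has_derivative_compose[OF this h'(2)]
      have "((\<lambda>u. f u \<bullet> n) has_derivative (\<lambda>x. h' (u, u) (x, x))) (at u)"
        using assms by (simp add: ec_flux_def)
      moreover have "(\<lambda>x. h' (u, u) (x, x)) = (*) (h' (u, u) (1, 1))"
      proof
        fix x :: real
        show "h' (u, u) (x, x) = h' (u, u) (1, 1) * x"
          using blinfun.scaleR_right[of "h' (u, u)" x "(1, 1)"] by (simp add: mult.commute)
      qed
      ultimately show ?thesis
        unfolding has_field_derivative_def by (simp only:)
    qed
    moreover have "continuous_on UNIV (\<lambda>u. h' (u, u) (1, 1))"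
      by (rule continuous_on_compose2[OF continuous_on_product_then_coordinatewise[OF h'(1)]])
        (auto intro!: continuous_intros)
    ultimately show ?thesis by blast
  qed
  then have "\<forall>n. \<exists>d. continuous_on UNIV d \<and> (\<forall>u. ((\<lambda>u. f u \<bullet> n) has_real_derivative d u) (at u))" ..
  from choice[OF this]
  have "\<exists>d. \<forall>n. continuous_on UNIV (d n) \<and> (\<forall>u. ((\<lambda>u. f u \<bullet> n) has_real_derivative d n u) (at u))" .
  then obtain d where d: "\<And>n. continuous_on UNIV (d n)"
    "\<And>n u. ((\<lambda>u. f u \<bullet> n) has_real_derivative d n u) (at u)"
    by blast
  define f' where "f' u = (\<Sum>b\<in>Basis. d b u *\<^sub>R b)" for u
  have "f' u \<bullet> b = d b u" if "b \<in> Basis" for u b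
    using that by (simp add: f'_def inner_sum_left inner_Basis if_distrib cong: if_cong)
  then have "(f has_vector_derivative f' u) (at u)" for u
    using d(2)[of _ u] unfolding has_vector_derivative_def has_field_derivative_def
    by (subst has_derivative_componentwise_within) (simp add: mult_commute_abs)
  moreover have "continuous_on UNIV f'"
    unfolding f'_def by (intro continuous_intros d(1))
  ultimately show thesis by (rule that)
qed

lemma has_real_derivative_inner_left:
  assumes "(F has_vector_derivative F') (at u)"
  shows "((\<lambda>u. F u \<bullet> n) has_real_derivative F' \<bullet> n) (at u)"
  using bounded_linear.has_vector_derivative[OF bounded_linear_inner_left assms]
  by (simp add: has_real_derivative_iff_has_vector_derivative)

text \<open>On the compact interval from \<open>m\<close> to \<open>M\<close> a bound for
  \<open>f'\<close> bounds all difference quotients, so \<open>L_flux\<close> is a genuine supremum.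
  Scaling then passes from unit vectors to arbitrary \<open>n\<close>.\<close>

lemma L_flux_bound:
  assumes f': "\<And>u. (f has_vector_derivative f' u) (at u)" "continuous_on UNIV f'"
    and xy: "x \<in> {m..M}" "y \<in> {m..M}"
  shows "\<bar>(f x - f y) \<bullet> n\<bar> \<le> L_flux m M f * norm n * \<bar>x - y\<bar>"
proof (cases "x = y \<or> n = 0")
  case False
  let ?A = "{\<bar>(f u - f w) \<bullet> n\<bar> / \<bar>u - w\<bar> | u w n. u \<in> {m..M} \<and> w \<in> {m..M} \<and> u \<noteq> w \<and> norm n = 1}"
  have "bounded (f' ` {m..M})"
    using f'(2) by (intro compact_imp_bounded compact_continuous_image) (auto intro: continuous_on_subset)
  then obtain B where B: "\<And>u. u \<in> {m..M} \<Longrightarrow> norm (f' u) \<le> B"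
    unfolding bounded_iff by blast
  have "\<bar>(f u - f w) \<bullet> n\<bar> / \<bar>u - w\<bar> \<le> B"
    if a: "u \<in> {m..M}" "w \<in> {m..M}" "u \<noteq> w" "norm n = 1" for u w n
  proof -
    have "norm (f u \<bullet> n - f w \<bullet> n) \<le> B * norm (u - w)"
    proof (rule field_differentiable_bound[of "{m..M}"])
      fix z assume "z \<in> {m..M}"
      then show "norm (f' z \<bullet> n) \<le> B"
        using Cauchy_Schwarz_ineq2[of "f' z" n] B[of z] a(4) by simp
    qed (use a in \<open>auto intro!: has_field_derivative_at_within has_real_derivative_inner_left f'\<close>)
    then show ?thesis
      using a by (simp add: divide_le_eq inner_diff_left)
  qed
  then have "bdd_above ?A"
    by (intro bdd_aboveI[of _ B]) blast
  moreover have "\<bar>(f x - f y) \<bullet> (n /\<^sub>R norm n)\<bar> / \<bar>x - y\<bar> \<in> ?A"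
    using False xy by (intro CollectI exI[of _ x] exI[of _ y] exI[of _ "n /\<^sub>R norm n"]) auto
  ultimately have "\<bar>(f x - f y) \<bullet> (n /\<^sub>R norm n)\<bar> / \<bar>x - y\<bar> \<le> L_flux m M f"
    unfolding L_flux_def by (rule cSup_upper[rotated])
  then show ?thesis
    using False by (simp add: abs_mult field_simps)
qed auto

text \<open>The derivative of \<open>q\<close> is \<open>deriv \<eta>\<close> times that of
  \<open>f\<close>; it cancels one term of the product rule.\<close>

lemma entropy_potential_derivative:
  assumes f': "\<And>u. (f has_vector_derivative f' u) (at u)" "continuous_on UNIV f'"
    and pair: "entropy_pair f \<eta> q" and \<eta>: "\<And>u. deriv \<eta> field_differentiable at u"
  shows "((\<lambda>u. entropy_potential f \<eta> q u \<bullet> n) has_real_derivative deriv (deriv \<eta>) u * (f u \<bullet> n)) (at u)"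
proof -
  have D: "(deriv \<eta> has_real_derivative deriv (deriv \<eta>) u) (at u)" for u
    using \<eta> by (simp add: field_differentiable_derivI)
  let ?k = "\<lambda>w. deriv \<eta> w *\<^sub>R f' w"
  have "continuous_on UNIV (deriv \<eta>)"
    by (intro continuous_at_imp_continuous_on ballI DERIV_isCont[OF D])
  \<comment> \<open>The window of radius \<open>1\<close> keeps \<open>u\<close> interior, so the
    derivative within it is a full derivative. Continuity of the integrand makes \<open>q\<close> a
    classical primitive there.\<close>
  then have cont: "continuous_on {u - 1..u + 1} ?k"
    using f'(2) by (intro continuous_intros) (auto intro: continuous_on_subset)
  have "(?k has_integral q x - q (u - 1)) {u - 1..x}" if "u - 1 \<le> x" for x
    using pair that vector_derivative_at[OF f'(1)] unfolding entropy_pair_def by auto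
  note integral = this
  have q: "q x = q (u - 1) + integral {u - 1..x} ?k" if "x \<in> {u - 1..u + 1}" for x
    using integral_unique[OF integral[of x]] that by simp
  have "((\<lambda>x. integral {u - 1..x} ?k) has_vector_derivative ?k u) (at u within {u - 1..u + 1})"
    by (rule integral_has_vector_derivative[OF cont]) simp
  from has_vector_derivative_add[OF has_vector_derivative_const this]
  have "((\<lambda>x. q (u - 1) + integral {u - 1..x} ?k) has_vector_derivative ?k u) (at u within {u - 1..u + 1})"
    unfolding add_0 .
  then have "(q has_vector_derivative ?k u) (at u within {u - 1..u + 1})"
    by (rule has_vector_derivative_transform[rotated 2]) (simp_all only: q, simp)
  then have "(q has_vector_derivative ?k u) (at u)"
    by (simp add: at_within_Icc_at)
  then have "((\<lambda>u. q u \<bullet> n) has_real_derivative deriv \<eta> u * (f' u \<bullet> n)) (at u)"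
    by (auto dest: has_real_derivative_inner_left)
  moreover have "((\<lambda>u. f u \<bullet> n) has_real_derivative f' u \<bullet> n) (at u)"
    by (rule has_real_derivative_inner_left[OF f'(1)])
  ultimately have "((\<lambda>u. deriv \<eta> u * (f u \<bullet> n) - q u \<bullet> n) has_real_derivative deriv (deriv \<eta>) u * (f u \<bullet> n)) (at u)"
    by (auto intro!: derivative_eq_intros D)
  then show ?thesis
    by (simp add: entropy_potential_def inner_diff_left)
qed

text \<open>Entropy conservation says that \<open>?F\<close> takes equal values at the two states.
  Its derivative is \<open>deriv (deriv \<theta>) z * (f z \<bullet> n - hec x y n)\<close>, so
  Rolle's theorem and strict convexity of \<open>\<theta>\<close> give the mean value.\<close>

lemma ec_flux_mean_value:
  assumes ec: "ec_flux f \<theta> g hec" and pair: "entropy_pair f \<theta> g"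
    and v: "\<And>x. deriv \<theta> field_differentiable at x" "\<And>x. 0 < deriv (deriv \<theta>) x"
  obtains \<xi> where "\<xi> \<in> closed_segment x y" and "hec x y n = f \<xi> \<bullet> n"
proof (cases "x = y")
  case True
  then show ?thesis
    using ec by (intro that[of x]) (auto simp: ec_flux_def)
next
  case False
  obtain f' where f': "\<And>u. (f has_vector_derivative f' u) (at u)" "continuous_on UNIV f'"
    using ec_flux_imp_C1[OF ec] by blast
  let ?F = "\<lambda>z. entropy_potential f \<theta> g z \<bullet> n - hec x y n * deriv \<theta> z"
  have "(?F has_real_derivative deriv (deriv \<theta>) z * (f z \<bullet> n - hec x y n)) (at z)" for z
    by (auto intro!: derivative_eq_intros entropy_potential_derivative[OF f' pair v(1)]
        field_differentiable_derivI v(1) simp: algebra_simps)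
  moreover have "?F x = ?F y"
  proof -
    have "(deriv \<theta> y - deriv \<theta> x) * hec x y n =
        (entropy_potential f \<theta> g y - entropy_potential f \<theta> g x) \<bullet> n"
      using ec by (simp add: ec_flux_def)
    then show ?thesis
      by (simp add: inner_diff_left algebra_simps)
  qed
  ultimately obtain \<xi> where "\<xi> \<in> closed_segment x y" "deriv (deriv \<theta>) \<xi> * (f \<xi> \<bullet> n - hec x y n) = 0"
    using False by (rule rolle_closed_segment)
  then show ?thesis
    using v(2)[of \<xi>] by (intro that[of \<xi>]) auto
qed

lemma abs_diff_closed_segment_le:
  fixes x y :: real
  assumes "a \<in> closed_segment x y" "b \<in> closed_segment x y"
  shows "\<bar>a - b\<bar> \<le> \<bar>x - y\<bar>"
  using assms by (auto simp: closed_segment_eq_real_ivl split: if_splits)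

text \<open>The flux \<open>hec\<close> is built for \<open>\<theta>\<close>, but as a value of
  \<open>f\<close> along \<open>n\<close> between the states it differs from
  \<open>f w \<bullet> n\<close>, for any \<open>w\<close> between them, by at most
  \<open>L_flux m M f * norm n\<close> times their distance. This controls the production of any
  other entropy \<open>\<eta>\<close>.\<close>

lemma ec_flux_entropy_production:
  assumes ec: "ec_flux f \<theta> g hec" and \<theta>: "entropy_pair f \<theta> g"
      "\<And>x. deriv \<theta> field_differentiable at x" "\<And>x. 0 < deriv (deriv \<theta>) x"
    and \<eta>: "entropy_pair f \<eta> q"
      "\<And>x. deriv \<eta> field_differentiable at x" "\<And>x. 0 \<le> deriv (deriv \<eta>) x"
    and xy: "x \<in> {m..M}" "y \<in> {m..M}"
  shows "\<bar>(deriv \<eta> x - deriv \<eta> y) * hec x y n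
      - (entropy_potential f \<eta> q x \<bullet> n - entropy_potential f \<eta> q y \<bullet> n)\<bar>
    \<le> L_flux m M f * norm n * ((deriv \<eta> x - deriv \<eta> y) * (x - y))"
proof -
  obtain f' where f': "\<And>u. (f has_vector_derivative f' u) (at u)" "continuous_on UNIV f'"
    using ec_flux_imp_C1[OF ec] by blast
  obtain \<xi> where \<xi>: "\<xi> \<in> closed_segment x y" "hec x y n = f \<xi> \<bullet> n"
    using ec_flux_mean_value[OF ec \<theta>] by blast
  have seg: "closed_segment x y \<subseteq> {m..M}"
    using xy by (intro closed_segment_subset) auto
  show ?thesis
  proof (rule entropy_production_bound[OF field_differentiable_derivI[OF \<eta>(2)] \<eta>(3)
        entropy_potential_derivative[OF f' \<eta>(1,2)]])
    fix w assume w: "w \<in> closed_segment x y"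
    have "\<bar>hec x y n - f w \<bullet> n\<bar> \<le> L_flux m M f * norm n * \<bar>\<xi> - w\<bar>"
      using L_flux_bound[OF f', of \<xi> m M w n] \<xi> subsetD[OF seg w] subsetD[OF seg \<xi>(1)]
      by (simp add: inner_diff_left)
    also have "\<dots> \<le> L_flux m M f * norm n * \<bar>x - y\<bar>"
    \<comment> \<open>For distinct states the sign of \<open>L_flux m M f * norm n\<close> follows
      from \<open>L_flux_bound\<close>; for equal ones \<open>\<xi>\<close> and \<open>w\<close>
      coincide. The distinction matters because for \<open>m = M\<close> the supremum is over an
      empty set.\<close>
    proof (cases "x = y")
      case False
      then have "0 \<le> L_flux m M f * norm n * \<bar>x - y\<bar>"
        using L_flux_bound[OF f' xy, of n] abs_ge_zero order_trans by blast
      then have "0 \<le> L_flux m M f * norm n"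
        using False by (simp add: zero_le_mult_iff)
      then show ?thesis
        using abs_diff_closed_segment_le[OF \<xi>(1) w] by (rule mult_left_mono[rotated])
    qed (use \<xi> w in auto)
    finally show "\<bar>hec x y n - f w \<bullet> n\<bar> \<le> L_flux m M f * norm n * \<bar>x - y\<bar>" .
  qed
qed

text \<open>The analogue in time: the flux is the identity, with Lipschitz constant
  \<open>1\<close>.\<close>

lemma U_ec_entropy_production:
  assumes \<theta>: "\<And>x. deriv \<theta> field_differentiable at x" "\<And>x. 0 < deriv (deriv \<theta>) x"
    and \<eta>: "\<And>x. \<eta> field_differentiable at x" "\<And>x. deriv \<eta> field_differentiable at x"
      "\<And>x. 0 \<le> deriv (deriv \<eta>) x"
  shows "\<bar>(deriv \<eta> x - deriv \<eta> y) * U_ec \<theta> x y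
      - ((deriv \<eta> x * x - \<eta> x) - (deriv \<eta> y * y - \<eta> y))\<bar>
    \<le> (deriv \<eta> x - deriv \<eta> y) * (x - y)"
  using entropy_production_bound[OF field_differentiable_derivI[OF \<eta>(2)] \<eta>(3)
      time_potential_derivative[OF \<eta>(1,2)], of x y "U_ec \<theta> x y" 1]
    abs_diff_closed_segment_le[OF U_ec_bounds[OF \<theta>]] by simp

text \<open>Taking \<open>u\<close> itself as left state in the entropy inequality turns
  \<open>h u u n\<close> and \<open>Q u u n\<close> into physical fluxes. The tangent of
  \<open>\<eta>\<close> at \<open>u\<close> bounds the left side from below, and the factor
  \<open>1 / (2 * \<alpha>)\<close> cancels.\<close>

lemma interface_entropy_dissipation:
  assumes h: "interface_flux m M f h" and Q: "numerical_entropy_flux m M f h \<eta> q Q"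
    and \<eta>: "entropy_pair f \<eta> q" and uw: "u \<in> {m..M}" "w \<in> {m..M}" and n: "norm n = 1"
  shows "Q u w n \<le> deriv \<eta> u * (h u w n - f u \<bullet> n) + q u \<bullet> n"
proof -
  define \<alpha> where "\<alpha> = max 1 (L_flux m M f)"
  have \<alpha>: "0 < \<alpha>" "L_flux m M f \<le> \<alpha>" by (auto simp: \<alpha>_def)
  have "h u u n = f u \<bullet> n"
    using h uw n by (simp add: interface_flux_def)
  moreover have "Q u u n = q u \<bullet> n"
    using Q uw n by (simp add: numerical_entropy_flux_def)
  moreover have "\<eta> (u - (h u w n - h u u n) / (2 * \<alpha>)) \<le> \<eta> u - (Q u w n - Q u u n) / (2 * \<alpha>)"
    using Q uw n \<alpha> unfolding numerical_entropy_flux_def by blast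
  moreover have "\<eta> u + deriv \<eta> u * ((u - (h u w n - h u u n) / (2 * \<alpha>)) - u)
      \<le> \<eta> (u - (h u w n - h u u n) / (2 * \<alpha>))"
    using \<eta> by (intro convex_on_tangent) (auto simp: entropy_pair_def)
  ultimately have "(Q u w n - q u \<bullet> n) / (2 * \<alpha>) \<le> deriv \<eta> u * (h u w n - f u \<bullet> n) / (2 * \<alpha>)"
    by simp
  then show ?thesis
    using \<alpha>(1) by (simp add: divide_le_cancel)
qed

section \<open>Element and face nodes\<close>

text \<open>\<open>lag S k\<close> and its reflection have the same integral, and the rule evaluates
  these integrals to \<open>wt S k\<close> and \<open>wt S l\<close>. The symmetry of the nodes is
  supplied by the mesh geometry in \<open>face_numbering\<close>.\<close>

lemma gauss_lobatto_wt_reflect: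
  assumes S: "gauss_lobatto S" and sym: "\<And>i. i \<le> degr S \<Longrightarrow> \<exists>j\<le>degr S. pt S j = - pt S i"
    and k: "k \<le> degr S" and l: "l \<le> degr S" and kl: "pt S l = - pt S k"
  shows "wt S l = wt S k"
proof -
  let ?P = "pcompose (lag S k) [:0, -1:]"
  have le: "degr S \<le> 2 * degr S - 1"
    using gauss_lobatto_degr_pos[OF S] by linarith
  have "degree ?P \<le> 2 * degr S - 1"
    using degree_lag[OF k] le degree_pcompose_le[of "lag S k" "[:0, -1:]"] by simp
  from gauss_lobatto_exact[OF S this]
  have "(poly ?P has_integral (\<Sum>i\<le>degr S. wt S i * poly ?P (pt S i))) {-1..1}" .
  moreover have "poly ?P (pt S i) = (if i = l then 1 else 0)" if i: "i \<le> degr S" for i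
  proof -
    obtain j where j: "j \<le> degr S" "pt S j = - pt S i"
      using sym[OF i] by blast
    have "k = j \<longleftrightarrow> i = l"
      using gauss_lobatto_pt_eq_iff[OF S k j(1)] gauss_lobatto_pt_eq_iff[OF S i l] j(2) kl by auto
    then show ?thesis
      using poly_lag[OF S k j(1)] j(2) by (simp add: poly_pcompose)
  qed
  ultimately have "(poly ?P has_integral wt S l) {-1..1}"
    using l by (simp add: if_distrib cong: if_cong)
  moreover have "(poly (lag S k) has_integral (\<Sum>i\<le>degr S. wt S i * poly (lag S k) (pt S i))) {-1..1}"
    using degree_lag[OF k] le by (intro gauss_lobatto_exact[OF S]) linarith
  then have "(poly (lag S k) has_integral wt S k) {-1..1}"
    using k by (simp add: poly_lag[OF S k] if_distrib cong: if_cong)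
  then have "((\<lambda>x. poly (lag S k) (- x)) has_integral wt S k) {-1..- (- 1)}"
    by (subst has_integral_reflect_real) simp
  then have "(poly ?P has_integral wt S k) {-1..1}"
    by (simp add: poly_pcompose[abs_def])
  ultimately show ?thesis
    by (rule has_integral_unique)
qed

text \<open>Nodes are numbered by the reference coordinate along the side, whereas \<open>xe\<close>
  follows the edge parametrization, possibly in the opposite direction.\<close>

definition face_node :: "mesh \<Rightarrow> (real^2) set \<Rightarrow> side \<Rightarrow> nat \<Rightarrow> real^2" where
  "face_node G \<kappa> \<sigma> k = (case \<sigma> of West \<Rightarrow> node G \<kappa> 0 k | East \<Rightarrow> node G \<kappa> (degr (sp G)) k
     | South \<Rightarrow> node G \<kappa> k 0 | North \<Rightarrow> node G \<kappa> k (degr (sp G)))"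

text \<open>Signed so as to point outward on every side; \<open>face_normal_eq\<close> identifies it
  with the unit normal scaled by the edge Jacobian.\<close>

definition face_normal :: "mesh \<Rightarrow> (real^2) set \<Rightarrow> side \<Rightarrow> nat \<Rightarrow> real^2" where
  "face_normal G \<kappa> \<sigma> k = (case \<sigma> of West \<Rightarrow> - n_xi G \<kappa> 0 0 k
     | East \<Rightarrow> n_xi G \<kappa> (degr (sp G)) (degr (sp G)) k
     | South \<Rightarrow> - n_zeta G \<kappa> k 0 0 | North \<Rightarrow> n_zeta G \<kappa> k (degr (sp G)) (degr (sp G)))"

lemma vector_2_mem_square:
  "(vector [x, y] :: real^2) \<in> cbox (-1) 1 \<longleftrightarrow> x \<in> {-1..1} \<and> y \<in> {-1..1}"
  by (auto simp: mem_box_cart forall_2)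

lemma vector_2_eq_iff: "(vector [x, y] :: real^2) = vector [x', y'] \<longleftrightarrow> x = x' \<and> y = y'"
  by (auto simp: vec_eq_iff forall_2)

lemma side_pt_mem_square:
  assumes "s \<in> {-1..1}"
  shows "side_pt \<sigma> s \<in> cbox (-1) 1"
  using assms by (cases \<sigma>) (auto simp: vector_2_mem_square)

lemma sum_delta_pair:
  fixes X :: "nat \<Rightarrow> nat \<Rightarrow> 'a :: real_vector"
  assumes "a \<le> s" "b \<le> s"
  shows "(\<Sum>i\<le>s. \<Sum>j\<le>s. (if i = a \<and> j = b then 1 else 0) *\<^sub>R X i j) = X a b"
proof -
  have "(\<Sum>i\<le>s. \<Sum>j\<le>s. (if i = a \<and> j = b then 1 else 0) *\<^sub>R X i j) =
      (\<Sum>i\<le>s. if i = a then (\<Sum>j\<le>s. if j = b then X i j else 0) else 0)"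
    by (intro sum.cong refl) (simp add: if_distrib[of "\<lambda>c. c *\<^sub>R _"] cong: if_cong)
  then show ?thesis
    using assms by simp
qed

context dg_mesh
begin

lemma xmap_ref_node:
  assumes "i \<le> degr (sp G)" "j \<le> degr (sp G)"
  shows "xmap G \<kappa> (vector [pt (sp G) i, pt (sp G) j]) = node G \<kappa> i j"
proof -
  have "xmap G \<kappa> (vector [pt (sp G) i, pt (sp G) j]) =
      (\<Sum>i'\<le>degr (sp G). \<Sum>j'\<le>degr (sp G). (if i' = i \<and> j' = j then 1 else 0) *\<^sub>R node G \<kappa> i' j')"
    unfolding xmap_def vector_2 using assms by (intro sum.cong refl) (auto simp: poly_lag[OF rule])
  then show ?thesis
    using assms by (simp only: sum_delta_pair)
qed

lemma ref_node_mem_square: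
  assumes "i \<le> degr (sp G)" "j \<le> degr (sp G)"
  shows "vector [pt (sp G) i, pt (sp G) j] \<in> cbox (-1) (1 :: real^2)"
  using gauss_lobatto_pt_bounds[OF rule] assms by (simp add: vector_2_mem_square)

lemma phi_node:
  assumes \<kappa>: "\<kappa> \<in> elems G" and "i \<le> degr (sp G)" "j \<le> degr (sp G)" "a \<le> degr (sp G)" "b \<le> degr (sp G)"
  shows "phi G \<kappa> i j (node G \<kappa> a b) = (if i = a \<and> j = b then 1 else 0)"
proof -
  have "inv_into (cbox (-1) 1) (xmap G \<kappa>) (node G \<kappa> a b) = vector [pt (sp G) a, pt (sp G) b]"
    using inv_into_f_f[OF elem_inj[OF \<kappa>] ref_node_mem_square[of a b]] assms
    by (simp add: xmap_ref_node)
  then show ?thesis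
    using assms by (simp add: phi_def poly_lag[OF rule])
qed

lemma sum_phi_node:
  fixes X :: "nat \<Rightarrow> nat \<Rightarrow> real"
  assumes "\<kappa> \<in> elems G" "a \<le> degr (sp G)" "b \<le> degr (sp G)"
  shows "(\<Sum>i\<le>degr (sp G). \<Sum>j\<le>degr (sp G). phi G \<kappa> i j (node G \<kappa> a b) * X i j) = X a b"
  using sum_delta_pair[OF assms(2,3), of X] by (simp add: phi_node assms cong: sum.cong_simp)

lemma u_space_node:
  assumes "\<kappa> \<in> elems G" "a \<le> degr (sp G)" "b \<le> degr (sp G)"
  shows "u_space G W \<kappa> (node G \<kappa> a b) = W \<kappa> a b"
  unfolding u_space_def by (rule sum_phi_node[OF assms])

lemma edge_node:
  assumes "\<kappa> \<in> elems G" "e \<in> edges G \<kappa>" "k \<le> degr (sp G)"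
  obtains a b where "a \<le> degr (sp G)" "b \<le> degr (sp G)" "xe G e k = node G \<kappa> a b"
  using face_nodes[OF assms(1,2)] assms(3) by blast

lemma face_node_alt:
  assumes "k \<le> degr (sp G)"
  shows "face_node G \<kappa> \<sigma> k = xmap G \<kappa> (side_pt \<sigma> (pt (sp G) k))"
proof -
  have "pt (sp G) 0 = -1" "pt (sp G) (degr (sp G)) = 1"
    using rule by (auto simp: gauss_lobatto_def)
  then show ?thesis
    using xmap_ref_node[OF assms, of 0] xmap_ref_node[OF assms, of "degr (sp G)"]
      xmap_ref_node[OF _ assms, of 0] xmap_ref_node[OF _ assms, of "degr (sp G)"]
    by (cases \<sigma>) (simp_all add: face_node_def)
qed

text \<open>Two elements share the parametrization of an edge, so it may traverse a side backwards.
  Then \<open>\<pi>\<close> reflects the numbering, otherwise it is the identity; the weights are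
  the same in both cases.\<close>

lemma face_numbering:
  assumes \<kappa>: "\<kappa> \<in> elems G"
  obtains \<pi> where "bij_betw \<pi> {..degr (sp G)} {..degr (sp G)}"
    and "\<And>k. k \<le> degr (sp G) \<Longrightarrow> wt (sp G) (\<pi> k) = wt (sp G) k"
    and "\<And>k. k \<le> degr (sp G) \<Longrightarrow> xe G (edge G \<kappa> \<sigma>) k = face_node G \<kappa> \<sigma> (\<pi> k)"
  using watertight[OF \<kappa>, of \<sigma>]
proof
  assume "\<forall>s\<in>{-1..1}. emap G (edge G \<kappa> \<sigma>) s = xmap G \<kappa> (side_pt \<sigma> s)"
  then have "xe G (edge G \<kappa> \<sigma>) k = face_node G \<kappa> \<sigma> k" if "k \<le> degr (sp G)" for k
    using that gauss_lobatto_pt_bounds[OF rule that] by (simp only: xe_def face_node_alt)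
  then show thesis
    by (intro that[of "\<lambda>k. k"]) (auto simp: bij_betw_def)
next
  let ?s = "degr (sp G)"
  assume rev: "\<forall>s\<in>{-1..1}. emap G (edge G \<kappa> \<sigma>) s = xmap G \<kappa> (side_pt \<sigma> (- s))"
  have xe: "xe G (edge G \<kappa> \<sigma>) k = xmap G \<kappa> (side_pt \<sigma> (- pt (sp G) k))" if "k \<le> ?s" for k
    using rev gauss_lobatto_pt_bounds[OF rule that] by (simp only: xe_def)
  \<comment> \<open>An edge node is also an element node, so injectivity of the element mapping
    equates the reference coordinates: \<open>- pt (sp G) k\<close> must be a node of the
    rule.\<close>
  have refl: "\<exists>l\<le>?s. pt (sp G) l = - pt (sp G) k" if k: "k \<le> ?s" for k
  proof -
    have "edge G \<kappa> \<sigma> \<in> edges G \<kappa>"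
      by (cases \<sigma>) (auto simp: edges_def)
    then obtain a b where ab: "a \<le> ?s" "b \<le> ?s" "xe G (edge G \<kappa> \<sigma>) k = node G \<kappa> a b"
      using edge_node[OF \<kappa> _ k] by blast
    have mem: "- pt (sp G) k \<in> {-1..1}"
      using gauss_lobatto_pt_bounds[OF rule k] by auto
    have "xmap G \<kappa> (side_pt \<sigma> (- pt (sp G) k)) = xmap G \<kappa> (vector [pt (sp G) a, pt (sp G) b])"
      unfolding xmap_ref_node[OF ab(1,2)] xe[OF k, symmetric] by (rule ab(3))
    then have "side_pt \<sigma> (- pt (sp G) k) = vector [pt (sp G) a, pt (sp G) b]"
      by (rule inj_onD[OF elem_inj[OF \<kappa>] _ side_pt_mem_square[OF mem] ref_node_mem_square[OF ab(1,2)]])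
    then have "pt (sp G) a = - pt (sp G) k \<or> pt (sp G) b = - pt (sp G) k"
      by (cases \<sigma>) (auto simp: vector_2_eq_iff)
    then show ?thesis
      using ab(1,2) by blast
  qed
  define \<pi> where "\<pi> k = (SOME l. l \<le> ?s \<and> pt (sp G) l = - pt (sp G) k)" for k
  have \<pi>: "\<pi> k \<le> ?s" "pt (sp G) (\<pi> k) = - pt (sp G) k" if "k \<le> ?s" for k
    using someI_ex[OF refl[OF that]] unfolding \<pi>_def[symmetric] by auto
  \<comment> \<open>\<open>\<pi>\<close> is an involution, hence a bijection.\<close>
  have inv: "\<pi> (\<pi> k) = k" if "k \<le> ?s" for k
    using \<pi>[OF that] \<pi>[OF \<pi>(1)[OF that]] gauss_lobatto_pt_eq_iff[OF rule, of "\<pi> (\<pi> k)" k] that by simp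
  show thesis
  proof (rule that)
    show "bij_betw \<pi> {..?s} {..?s}"
      by (rule bij_betw_byWitness[of _ \<pi>]) (auto simp: inv \<pi>)
    show "wt (sp G) (\<pi> k) = wt (sp G) k" if "k \<le> ?s" for k
      using gauss_lobatto_wt_reflect[OF rule refl that \<pi>[OF that]] .
    show "xe G (edge G \<kappa> \<sigma>) k = face_node G \<kappa> \<sigma> (\<pi> k)" if "k \<le> ?s" for k
      using \<pi>[OF that] by (simp only: xe[OF that] face_node_alt)
  qed
qed

lemma face_normal_eq:
  assumes "\<kappa> \<in> elems G" "j \<le> degr (sp G)" "k \<le> degr (sp G)"
    and "xe G (edge G \<kappa> \<sigma>) k = face_node G \<kappa> \<sigma> j"
  shows "Je G (edge G \<kappa> \<sigma>) k *\<^sub>R nrm G \<kappa> (edge G \<kappa> \<sigma>) k = face_normal G \<kappa> \<sigma> j"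
  using assms face_west[of \<kappa> j k] face_east[of \<kappa> j k] face_south[of \<kappa> j k] face_north[of \<kappa> j k]
  by (cases \<sigma>) (simp_all add: face_node_def face_normal_def)

text \<open>Passes from edge numbering and unit normals to element numbering and metric normals, in
  which the volume terms are expressed.\<close>

lemma face_sum:
  assumes \<kappa>: "\<kappa> \<in> elems G"
  shows "(\<Sum>k\<le>degr (sp G). wt (sp G) k * Je G (edge G \<kappa> \<sigma>) k *
      (F (xe G (edge G \<kappa> \<sigma>) k) \<bullet> nrm G \<kappa> (edge G \<kappa> \<sigma>) k)) =
    (\<Sum>j\<le>degr (sp G). wt (sp G) j * (F (face_node G \<kappa> \<sigma> j) \<bullet> face_normal G \<kappa> \<sigma> j))"
proof -
  obtain \<pi> where \<pi>: "bij_betw \<pi> {..degr (sp G)} {..degr (sp G)}"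
      "\<And>k. k \<le> degr (sp G) \<Longrightarrow> wt (sp G) (\<pi> k) = wt (sp G) k"
      "\<And>k. k \<le> degr (sp G) \<Longrightarrow> xe G (edge G \<kappa> \<sigma>) k = face_node G \<kappa> \<sigma> (\<pi> k)"
    using face_numbering[OF \<kappa>] by blast
  have "(\<Sum>k\<le>degr (sp G). wt (sp G) k * Je G (edge G \<kappa> \<sigma>) k *
      (F (xe G (edge G \<kappa> \<sigma>) k) \<bullet> nrm G \<kappa> (edge G \<kappa> \<sigma>) k)) =
    (\<Sum>k\<le>degr (sp G). wt (sp G) (\<pi> k) * (F (face_node G \<kappa> \<sigma> (\<pi> k)) \<bullet> face_normal G \<kappa> \<sigma> (\<pi> k)))"
  proof (intro sum.cong refl)
    fix k assume "k \<in> {..degr (sp G)}"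
    then have k: "k \<le> degr (sp G)" and \<pi>k: "\<pi> k \<le> degr (sp G)"
      using \<pi>(1) by (auto simp: bij_betw_def)
    show "wt (sp G) k * Je G (edge G \<kappa> \<sigma>) k * (F (xe G (edge G \<kappa> \<sigma>) k) \<bullet> nrm G \<kappa> (edge G \<kappa> \<sigma>) k) =
        wt (sp G) (\<pi> k) * (F (face_node G \<kappa> \<sigma> (\<pi> k)) \<bullet> face_normal G \<kappa> \<sigma> (\<pi> k))"
      unfolding face_normal_eq[OF \<kappa> \<pi>k k \<pi>(3)[OF k], symmetric] \<pi>(2)[OF k] \<pi>(3)[OF k]
      by (simp add: mult.assoc)
  qed
  then show ?thesis
    by (simp only: sum.reindex_bij_betw[OF \<pi>(1), of "\<lambda>j. wt (sp G) j * (F (face_node G \<kappa> \<sigma> j) \<bullet> face_normal G \<kappa> \<sigma> j)"])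
qed

text \<open>A sum over the set \<open>edges G \<kappa>\<close> counts coinciding edges only once, so
  the four edges have to be shown distinct.\<close>

lemma sum_edges:
  fixes F :: "(real^2) set \<Rightarrow> 'a :: comm_monoid_add"
  assumes \<kappa>: "\<kappa> \<in> elems G"
  shows "(\<Sum>e\<in>edges G \<kappa>. F e) =
    F (edge G \<kappa> West) + F (edge G \<kappa> East) + F (edge G \<kappa> South) + F (edge G \<kappa> North)"
proof -
  have "\<sigma> = \<tau>" if eq: "edge G \<kappa> \<sigma> = edge G \<kappa> \<tau>" for \<sigma> \<tau>
  proof -
    \<comment> \<open>The midpoint of the reference side is used because a corner lies on two
      sides.\<close>
    have "xmap G \<kappa> (side_pt \<sigma> 0) \<in> edge G \<kappa> \<sigma>"
      unfolding edge_def by (rule imageI) simp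
    then obtain s where s: "xmap G \<kappa> (side_pt \<sigma> 0) = xmap G \<kappa> (side_pt \<tau> s)" "s \<in> {-1..1}"
      unfolding eq unfolding edge_def by (rule imageE)
    have "side_pt \<sigma> 0 = side_pt \<tau> s"
      by (rule inj_onD[OF elem_inj[OF \<kappa>] s(1) side_pt_mem_square side_pt_mem_square[OF s(2)]]) simp
    then show ?thesis
      by (cases \<sigma>; cases \<tau>) (auto simp: vector_2_eq_iff)
  qed
  then have "inj_on (edge G \<kappa>) {West, East, South, North}"
    unfolding inj_on_def by blast
  then show ?thesis
    by (simp add: edges_def sum.reindex add.assoc)
qed

lemma neighbour_edge:
  assumes "\<kappa> \<in> elems G" "e \<in> edges G \<kappa>"
  shows "neighbour G \<kappa> e \<in> elems G" "e \<in> edges G (neighbour G \<kappa> e)"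
  using theI'[OF shared[OF assms]] unfolding neighbour_def by auto

text \<open>Edge nodes are nodes of each adjacent element, so a trace there is a degree of freedom
  and not an interpolated value, which might leave \<open>A\<close>.\<close>

lemma u_space_edge_mem:
  assumes W: "\<And>\<kappa> i j. \<kappa> \<in> elems G \<Longrightarrow> i \<le> degr (sp G) \<Longrightarrow> j \<le> degr (sp G) \<Longrightarrow> W \<kappa> i j \<in> A"
    and "\<kappa> \<in> elems G" "e \<in> edges G \<kappa>" "k \<le> degr (sp G)"
  shows "u_space G W \<kappa> (xe G e k) \<in> A"
  using edge_node[OF assms(2-4)] W u_space_node assms(2) by metis

end

lemma u_h_time_node:
  assumes T: "gauss_lobatto T" "r \<le> degr T" and dt: "t n < t (Suc n)"
  shows "u_h G T t U n \<kappa> x (time_node T t n r) = u_space G (U n r) \<kappa> x"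
proof -
  have "2 * (time_node T t n r - t n) / (t (Suc n) - t n) - 1 = pt T r"
    using dt by (simp add: time_node_def)
  then have "phi_time T t n s (time_node T t n r) = (if s = r then 1 else 0)" if "s \<le> degr T" for s
    using poly_lag[OF T(1) that T(2)] by (simp add: phi_time_def)
  then have "(\<Sum>s\<le>degr T. phi G \<kappa> i j x * phi_time T t n s (time_node T t n r) * U n s \<kappa> i j) =
      (\<Sum>s\<le>degr T. if s = r then phi G \<kappa> i j x * U n s \<kappa> i j else 0)" for i j
    by (intro sum.cong refl) auto
  then show ?thesis
    using T(2) by (simp add: u_h_def u_space_def)
qed

section \<open>Entropy balance in space and in time\<close>

text \<open>Here \<open>L\<close> is the Lipschitz constant of the flux, \<open>K\<close> the
  constant \<open>L_u\<close> and \<open>P\<close> the dissipation of a pair of states. As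
  \<open>K\<close> is at least \<open>1\<close>, it can be inserted as a factor.\<close>

lemma dissipation_bound:
  assumes S: "gauss_lobatto S" "k \<le> degr S" "l \<le> degr S" "k \<noteq> l"
    and L: "0 \<le> L" "1 \<le> K" and c: "L * K * max_D S \<le> c" and P: "0 \<le> P" and B: "B \<le> L * P"
  shows "\<bar>Dmat S k l\<bar> * B \<le> wt S l * (c * P)"
proof -
  have D: "\<bar>Dmat S k l\<bar> \<le> max_D S * wt S l"
    using S by (rule abs_Dmat_le_max_D)
  have "\<bar>Dmat S k l\<bar> * B \<le> \<bar>Dmat S k l\<bar> * (L * P)"
    using B by (simp add: mult_left_mono)
  also have "\<dots> \<le> (max_D S * wt S l) * (L * P)"
    using D L P by (intro mult_right_mono) auto
  also have "\<dots> = (max_D S * wt S l * L * P) * 1"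
    by simp
  also have "\<dots> \<le> (max_D S * wt S l * L * P) * K"
    using D L P order_trans[OF abs_ge_zero D] by (intro mult_left_mono) auto
  also have "\<dots> = (L * K * max_D S) * (wt S l * P)"
    by (simp add: mult_ac)
  also have "\<dots> \<le> c * (wt S l * P)"
    using c P gauss_lobatto_wt_pos[OF S(1,3)] by (intro mult_right_mono) auto
  finally show ?thesis
    by (simp add: mult_ac)
qed

lemma L_flux_nonneg:
  assumes "ec_flux f \<theta> g hec" and "m < M"
  shows "0 \<le> L_flux m M f"
proof -
  obtain f' where f': "\<And>u. (f has_vector_derivative f' u) (at u)" "continuous_on UNIV f'"
    using ec_flux_imp_C1[OF assms(1)] by blast
  have "0 \<le> L_flux m M f * norm (axis 1 1 :: real^2) * \<bar>m - M\<bar>"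
    using L_flux_bound[OF f', of m m M M "axis 1 1"] \<open>m < M\<close> abs_ge_zero order_trans
    by (metis atLeastAtMost_iff less_imp_le order_refl)
  then show ?thesis
    using \<open>m < M\<close> by (simp add: zero_le_mult_iff)
qed

locale entropy_stable_setting =
  fixes m M :: real and f :: "real \<Rightarrow> real^2" and \<theta> :: "real \<Rightarrow> real" and g :: "real \<Rightarrow> real^2"
    and hec :: "real \<Rightarrow> real \<Rightarrow> real^2 \<Rightarrow> real" and \<eta> :: "real \<Rightarrow> real" and qf :: "real \<Rightarrow> real^2"
  assumes \<theta>: "entropy_pair f \<theta> g" "\<And>u. deriv \<theta> field_differentiable at u" "\<And>u. 0 < deriv (deriv \<theta>) u"
    and hec: "ec_flux f \<theta> g hec"
    and \<eta>: "entropy_pair f \<eta> qf" "\<And>u. deriv \<eta> field_differentiable at u" "\<And>u. 0 \<le> deriv (deriv \<eta>) u"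
    and Lu_finite: "bdd_above (Lu_ratios m M \<theta>)"
begin

lemma \<eta>_diff: "\<eta> field_differentiable at u" and \<eta>_convex: "convex_on UNIV \<eta>"
  using \<eta>(1) by (auto simp: entropy_pair_def)

text \<open>Read off from the bound on an absolute value in
  \<open>U_ec_entropy_production\<close>.\<close>

lemma deriv_monotone: "0 \<le> (deriv \<eta> x - deriv \<eta> y) * (x - y)"
  using U_ec_entropy_production[OF \<theta>(2,3) \<eta>_diff \<eta>(2,3), of x y] by (rule order_trans[OF abs_ge_zero])

text \<open>The graph viscosity carries the factor \<open>d / 2\<close>, and
  \<open>sbp_entropy_production\<close> uses twice its coefficient; this leaves \<open>d / 4\<close>
  and explains the \<open>4\<close> in the lower bound for \<open>d\<close>. On the diagonal, which
  \<open>max_D\<close> omits, the states coincide and both sides vanish.\<close>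

lemma space_dissipation:
  assumes S: "gauss_lobatto S" "i \<le> degr S" "k \<le> degr S" and eq: "i = k \<Longrightarrow> x = y"
    and xy: "x \<in> {m..M}" "y \<in> {m..M}"
    and d: "4 * L_flux m M f * Sup (Lu_ratios m M \<theta>) * max_D S \<le> d"
  shows "\<bar>Dmat S i k\<bar> * \<bar>(deriv \<eta> x - deriv \<eta> y) * hec x y n
      - (entropy_potential f \<eta> qf x \<bullet> n - entropy_potential f \<eta> qf y \<bullet> n)\<bar>
    \<le> wt S k * (d / 4 * norm n * ((deriv \<eta> x - deriv \<eta> y) * (x - y)))"
proof (cases "x = y")
  case False
  then have "m < M" using xy by auto
  have "\<bar>Dmat S i k\<bar> * \<bar>(deriv \<eta> x - deriv \<eta> y) * hec x y n
      - (entropy_potential f \<eta> qf x \<bullet> n - entropy_potential f \<eta> qf y \<bullet> n)\<bar>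
    \<le> wt S k * (d / 4 * (norm n * ((deriv \<eta> x - deriv \<eta> y) * (x - y))))"
  proof (rule dissipation_bound[where L = "L_flux m M f" and K = "Sup (Lu_ratios m M \<theta>)"])
    show "1 \<le> Sup (Lu_ratios m M \<theta>)"
      by (rule Sup_Lu_ratios_ge_1[OF \<theta>(2,3) Lu_finite \<open>m < M\<close>])
    show "0 \<le> norm n * ((deriv \<eta> x - deriv \<eta> y) * (x - y))"
      by (intro mult_nonneg_nonneg deriv_monotone norm_ge_zero)
    show "\<bar>(deriv \<eta> x - deriv \<eta> y) * hec x y n
      - (entropy_potential f \<eta> qf x \<bullet> n - entropy_potential f \<eta> qf y \<bullet> n)\<bar>
      \<le> L_flux m M f * (norm n * ((deriv \<eta> x - deriv \<eta> y) * (x - y)))"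
      using ec_flux_entropy_production[OF hec \<theta> \<eta> xy] by (simp add: mult.assoc)
    show "0 \<le> L_flux m M f"
      by (rule L_flux_nonneg[OF hec \<open>m < M\<close>])
    show "L_flux m M f * Sup (Lu_ratios m M \<theta>) * max_D S \<le> d / 4"
      using d by simp
  qed (use S eq False in auto)
  then show ?thesis
    by (simp add: mult.assoc)
qed simp

text \<open>As in space, but with Lipschitz constant \<open>1\<close> and a viscosity without the
  factor one half, so the coefficient is \<open>d / 2\<close>.\<close>

lemma time_dissipation:
  assumes S: "gauss_lobatto S" "i \<le> degr S" "k \<le> degr S" and eq: "i = k \<Longrightarrow> x = y"
    and xy: "x \<in> {m..M}" "y \<in> {m..M}"
    and d: "2 * Sup (Lu_ratios m M \<theta>) * max_D S \<le> d"
  shows "\<bar>Dmat S i k\<bar> * \<bar>(deriv \<eta> x - deriv \<eta> y) * U_ec \<theta> x y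
      - ((deriv \<eta> x * x - \<eta> x) - (deriv \<eta> y * y - \<eta> y))\<bar>
    \<le> wt S k * (d / 2 * ((deriv \<eta> x - deriv \<eta> y) * (x - y)))"
proof (cases "x = y")
  case False
  then have "m < M" using xy by auto
  show ?thesis
  proof (rule dissipation_bound[where L = 1 and K = "Sup (Lu_ratios m M \<theta>)"])
    show "1 \<le> Sup (Lu_ratios m M \<theta>)"
      by (rule Sup_Lu_ratios_ge_1[OF \<theta>(2,3) Lu_finite \<open>m < M\<close>])
    show "0 \<le> (deriv \<eta> x - deriv \<eta> y) * (x - y)"
      by (rule deriv_monotone)
    show "\<bar>(deriv \<eta> x - deriv \<eta> y) * U_ec \<theta> x y
      - ((deriv \<eta> x * x - \<eta> x) - (deriv \<eta> y * y - \<eta> y))\<bar>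
      \<le> 1 * ((deriv \<eta> x - deriv \<eta> y) * (x - y))"
      using U_ec_entropy_production[OF \<theta>(2,3) \<eta>_diff \<eta>(2,3), of x y] by simp
    show "1 * Sup (Lu_ratios m M \<theta>) * max_D S \<le> d / 2"
      using d by simp
  qed (use S eq False in auto)
qed simp

text \<open>As \<open>U_ec\<close> of equal states is that state, the boundary terms of
  \<open>sbp_entropy_production\<close> reduce to \<open>\<eta> (y (degr T)) - \<eta> (y 0)\<close>.
  Convexity bounds the jump from \<open>y0\<close>, the end of the previous slab, to
  \<open>y 0\<close>.\<close>

lemma time_entropy_inequality:
  assumes T: "gauss_lobatto T" and y: "\<And>r. r \<le> degr T \<Longrightarrow> y r \<in> {m..M}"
    and d: "2 * Sup (Lu_ratios m M \<theta>) * max_D T \<le> d"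
  shows "\<eta> (y (degr T)) - \<eta> y0 \<le> (\<Sum>r\<le>degr T. deriv \<eta> (y r) * T_op T \<theta> d y y0 r)"
proof -
  let ?q = "degr T" and ?a = "\<lambda>r. deriv \<eta> (y r)"
  \<comment> \<open>The potential does not depend on \<open>k\<close>, so the vanishing row sums of
    \<open>Dmat\<close> remove the first term.\<close>
  have "2 * (\<Sum>i\<le>?q. wt T i * (\<Sum>k\<le>?q. Dmat T i k * (?a i * y i - \<eta> (y i))))
      + (?a ?q * U_ec \<theta> (y ?q) (y ?q) - (?a ?q * y ?q - \<eta> (y ?q)))
      - (?a 0 * U_ec \<theta> (y 0) (y 0) - (?a 0 * y 0 - \<eta> (y 0)))
    \<le> 2 * (\<Sum>i\<le>?q. ?a i * (\<Sum>k\<le>?q. Qmat T i k * U_ec \<theta> (y i) (y k)))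
      + 2 * (\<Sum>i\<le>?q. ?a i * (wt T i * (\<Sum>k\<le>?q. wt T k * (d / 2) * (y i - y k))))"
  proof (rule sbp_entropy_production[OF T U_ec_commute])
    fix i k assume "i \<le> ?q" "k \<le> ?q"
    then show "\<bar>Dmat T i k\<bar> * \<bar>(?a i - ?a k) * U_ec \<theta> (y i) (y k) - ((?a i * y i - \<eta> (y i)) - (?a k * y k - \<eta> (y k)))\<bar>
        \<le> wt T k * (d / 2 * ((?a i - ?a k) * (y i - y k)))"
      by (intro time_dissipation T y d) auto
  qed simp
  moreover have "(\<Sum>k\<le>?q. Dmat T i k * (?a i * y i - \<eta> (y i))) = 0" for i
    by (simp add: sum_distrib_right[symmetric] sum_Dmat[OF T])
  moreover have "2 * (\<Sum>i\<le>?q. ?a i * (wt T i * (\<Sum>k\<le>?q. wt T k * (d / 2) * (y i - y k)))) =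
      (\<Sum>i\<le>?q. ?a i * (d * wt T i * (\<Sum>k\<le>?q. wt T k * (y i - y k))))"
    by (simp add: sum_distrib_left mult_ac)
  moreover have "2 * (\<Sum>i\<le>?q. ?a i * (\<Sum>k\<le>?q. Qmat T i k * U_ec \<theta> (y i) (y k))) =
      (\<Sum>i\<le>?q. ?a i * (\<Sum>k\<le>?q. 2 * Qmat T i k * U_ec \<theta> (y i) (y k)))"
    by (simp add: sum_distrib_left mult_ac)
  moreover have "\<eta> (y 0) - \<eta> y0 \<le> ?a 0 * (y 0 - y0)"
    using convex_on_tangent[OF \<eta>_convex \<eta>_diff, of "y 0" y0] by (simp add: algebra_simps)
  moreover have "(\<Sum>r\<le>?q. ?a r * T_op T \<theta> d y y0 r) =
      (\<Sum>i\<le>?q. ?a i * (\<Sum>k\<le>?q. 2 * Qmat T i k * U_ec \<theta> (y i) (y k)))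
      + ?a 0 * (y 0 - y0) + (\<Sum>i\<le>?q. ?a i * (d * wt T i * (\<Sum>k\<le>?q. wt T k * (y i - y k))))"
    by (simp add: T_op_def distrib_left sum.distrib if_distrib[of "(*) _"] cong: if_cong)
  ultimately show ?thesis
    by (simp add: U_ec_same[OF \<theta>(2,3)])
qed

text \<open>On a single grid line the first term need not vanish, because the normals vary; it is
  kept until both directions are combined. At the ends,
  \<open>deriv \<eta> u * (f u \<bullet> n)\<close> minus the potential along \<open>n\<close> is
  the entropy flux \<open>qf u \<bullet> n\<close>.\<close>

lemma space_sbp:
  fixes w :: "nat \<Rightarrow> real" and N :: "nat \<Rightarrow> nat \<Rightarrow> real^2"
  assumes S: "gauss_lobatto S" and N: "\<And>i k. N i k = N k i"
    and w: "\<And>i. i \<le> degr S \<Longrightarrow> w i \<in> {m..M}"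
    and d: "4 * L_flux m M f * Sup (Lu_ratios m M \<theta>) * max_D S \<le> d"
  defines "s \<equiv> degr S"
  shows "2 * (\<Sum>i\<le>s. wt S i * (entropy_potential f \<eta> qf (w i) \<bullet> (\<Sum>k\<le>s. Dmat S i k *\<^sub>R N i k)))
      + qf (w s) \<bullet> N s s - qf (w 0) \<bullet> N 0 0
    \<le> 2 * (\<Sum>i\<le>s. deriv \<eta> (w i) * (\<Sum>k\<le>s. Qmat S i k * hec (w i) (w k) (N i k)))
      + (\<Sum>i\<le>s. deriv \<eta> (w i) * (d * wt S i * (\<Sum>k\<le>s. wt S k / 2 * norm (N i k) * (w i - w k))))"
proof -
  let ?a = "\<lambda>i. deriv \<eta> (w i)" and ?\<psi> = "\<lambda>i. entropy_potential f \<eta> qf (w i)"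
  have hec_sym: "hec x y n = hec y x n" and hec_same: "hec x x n = f x \<bullet> n" for x y n
    using hec by (auto simp: ec_flux_def)
  have "2 * (\<Sum>i\<le>s. wt S i * (\<Sum>k\<le>s. Dmat S i k * (?\<psi> i \<bullet> N i k)))
      + (?a s * hec (w s) (w s) (N s s) - ?\<psi> s \<bullet> N s s)
      - (?a 0 * hec (w 0) (w 0) (N 0 0) - ?\<psi> 0 \<bullet> N 0 0)
    \<le> 2 * (\<Sum>i\<le>s. ?a i * (\<Sum>k\<le>s. Qmat S i k * hec (w i) (w k) (N i k)))
      + 2 * (\<Sum>i\<le>s. ?a i * (wt S i * (\<Sum>k\<le>s. wt S k * (d / 4 * norm (N i k)) * (w i - w k))))"
    unfolding s_def
  proof (rule sbp_entropy_production[OF S])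
    fix i k
    show "hec (w i) (w k) (N i k) = hec (w k) (w i) (N k i)"
      using hec_sym N by simp
    show "d / 4 * norm (N i k) = d / 4 * norm (N k i)"
      using N by simp
    assume "i \<le> degr S" "k \<le> degr S"
    then show "\<bar>Dmat S i k\<bar> * \<bar>(?a i - ?a k) * hec (w i) (w k) (N i k) - (?\<psi> i \<bullet> N i k - ?\<psi> k \<bullet> N k i)\<bar>
        \<le> wt S k * (d / 4 * norm (N i k) * ((?a i - ?a k) * (w i - w k)))"
      unfolding N[of k i] by (intro space_dissipation S w d) auto
  qed
  moreover have "?a i * hec (w i) (w i) n - ?\<psi> i \<bullet> n = qf (w i) \<bullet> n" for i n
    by (simp add: hec_same entropy_potential_def inner_diff_left)
  moreover have "(\<Sum>k\<le>s. Dmat S i k * (?\<psi> i \<bullet> N i k)) = ?\<psi> i \<bullet> (\<Sum>k\<le>s. Dmat S i k *\<^sub>R N i k)" for i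
    by (simp add: inner_sum_right)
  moreover have "2 * (\<Sum>i\<le>s. ?a i * (wt S i * (\<Sum>k\<le>s. wt S k * (d / 4 * norm (N i k)) * (w i - w k)))) =
      (\<Sum>i\<le>s. ?a i * (d * wt S i * (\<Sum>k\<le>s. wt S k / 2 * norm (N i k) * (w i - w k))))"
    by (simp add: sum_distrib_left mult_ac)
  ultimately show ?thesis
    by simp
qed

end

lemma n_xi_commute: "n_xi G \<kappa> i k j = n_xi G \<kappa> k i j"
  and n_zeta_commute: "n_zeta G \<kappa> i j k = n_zeta G \<kappa> i k j"
  by (simp_all add: n_xi_def n_zeta_def add.commute)

context entropy_stable_setting
begin

text \<open>\<open>space_sbp\<close> is applied to every line in both reference directions and
  weighted by the quadrature in the other one. The interior terms then meet at each node and cancel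
  by the metric identities; the entropy fluxes through the four sides remain.\<close>

lemma element_volume_inequality:
  assumes mesh: "dg_mesh G \<Omega>" and \<kappa>: "\<kappa> \<in> elems G"
    and W: "\<And>i j. i \<le> degr (sp G) \<Longrightarrow> j \<le> degr (sp G) \<Longrightarrow> W i j \<in> {m..M}"
    and d: "4 * L_flux m M f * Sup (Lu_ratios m M \<theta>) * max_D (sp G) \<le> d"
  defines "s \<equiv> degr (sp G)" and "\<omega> \<equiv> wt (sp G)"
  shows "(\<Sum>j\<le>s. \<omega> j * (qf (W s j) \<bullet> n_xi G \<kappa> s s j - qf (W 0 j) \<bullet> n_xi G \<kappa> 0 0 j))
      + (\<Sum>i\<le>s. \<omega> i * (qf (W i s) \<bullet> n_zeta G \<kappa> i s s - qf (W i 0) \<bullet> n_zeta G \<kappa> i 0 0))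
    \<le> (\<Sum>i\<le>s. \<Sum>j\<le>s. deriv \<eta> (W i j) *
        (2 * (\<omega> j * (\<Sum>k\<le>s. Qmat (sp G) i k * hec (W i j) (W k j) (n_xi G \<kappa> i k j))
            + \<omega> i * (\<Sum>k\<le>s. Qmat (sp G) j k * hec (W i j) (W i k) (n_zeta G \<kappa> i j k)))
        + d * \<omega> i * \<omega> j * (\<Sum>k\<le>s. \<omega> k / 2 * norm (n_xi G \<kappa> i k j) * (W i j - W k j)
            + \<omega> k / 2 * norm (n_zeta G \<kappa> i j k) * (W i j - W i k))))"
proof -
  interpret dg_mesh G \<Omega> by (rule mesh)
  let ?a = "\<lambda>i j. deriv \<eta> (W i j)" and ?\<psi> = "\<lambda>i j. entropy_potential f \<eta> qf (W i j)"
  define MX where "MX i j = (\<Sum>k\<le>s. Dmat (sp G) i k *\<^sub>R n_xi G \<kappa> i k j)" for i j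
  define MZ where "MZ i j = (\<Sum>k\<le>s. Dmat (sp G) j k *\<^sub>R n_zeta G \<kappa> i j k)" for i j
  define HX where "HX i j = (\<Sum>k\<le>s. Qmat (sp G) i k * hec (W i j) (W k j) (n_xi G \<kappa> i k j))" for i j
  define HZ where "HZ i j = (\<Sum>k\<le>s. Qmat (sp G) j k * hec (W i j) (W i k) (n_zeta G \<kappa> i j k))" for i j
  define VX where "VX i j = (\<Sum>k\<le>s. \<omega> k / 2 * norm (n_xi G \<kappa> i k j) * (W i j - W k j))" for i j
  define VZ where "VZ i j = (\<Sum>k\<le>s. \<omega> k / 2 * norm (n_zeta G \<kappa> i j k) * (W i j - W i k))" for i j
  define BX where "BX j = qf (W s j) \<bullet> n_xi G \<kappa> s s j - qf (W 0 j) \<bullet> n_xi G \<kappa> 0 0 j" for j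
  define BZ where "BZ i = qf (W i s) \<bullet> n_zeta G \<kappa> i s s - qf (W i 0) \<bullet> n_zeta G \<kappa> i 0 0" for i
  have \<omega>: "0 \<le> \<omega> i" if "i \<in> {..s}" for i
    using gauss_lobatto_wt_pos[OF rule, of i] that by (simp add: \<omega>_def s_def)
  have X: "2 * (\<Sum>i\<le>s. \<omega> i * (?\<psi> i j \<bullet> MX i j)) + BX j
      \<le> 2 * (\<Sum>i\<le>s. ?a i j * HX i j) + (\<Sum>i\<le>s. ?a i j * (d * \<omega> i * VX i j))" if "j \<in> {..s}" for j
    using space_sbp[where N = "\<lambda>i k. n_xi G \<kappa> i k j" and w = "\<lambda>i. W i j" and d = d, OF rule n_xi_commute] W d that
    by (simp add: s_def \<omega>_def MX_def HX_def VX_def BX_def)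
  have Z: "2 * (\<Sum>j\<le>s. \<omega> j * (?\<psi> i j \<bullet> MZ i j)) + BZ i
      \<le> 2 * (\<Sum>j\<le>s. ?a i j * HZ i j) + (\<Sum>j\<le>s. ?a i j * (d * \<omega> j * VZ i j))" if "i \<in> {..s}" for i
    using space_sbp[where N = "\<lambda>j k. n_zeta G \<kappa> i j k" and w = "\<lambda>j. W i j" and d = d, OF rule n_zeta_commute] W d that
    by (simp add: s_def \<omega>_def MZ_def HZ_def VZ_def BZ_def)
  have metric: "MX i j + MZ i j = 0" if "i \<in> {..s}" "j \<in> {..s}" for i j
    using metric_identities[OF \<kappa>, of i j] that by (simp add: MX_def MZ_def s_def sum.distrib)
  have "(\<Sum>j\<le>s. \<omega> j * (2 * (\<Sum>i\<le>s. \<omega> i * (?\<psi> i j \<bullet> MX i j))))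
      + (\<Sum>i\<le>s. \<omega> i * (2 * (\<Sum>j\<le>s. \<omega> j * (?\<psi> i j \<bullet> MZ i j))))
    = (\<Sum>j\<le>s. \<Sum>i\<le>s. 2 * \<omega> i * \<omega> j * (?\<psi> i j \<bullet> MX i j))
      + (\<Sum>i\<le>s. \<Sum>j\<le>s. 2 * \<omega> i * \<omega> j * (?\<psi> i j \<bullet> MZ i j))"
    by (simp add: sum_distrib_left mult_ac)
  also have "\<dots> = (\<Sum>i\<le>s. \<Sum>j\<le>s. 2 * \<omega> i * \<omega> j * (?\<psi> i j \<bullet> (MX i j + MZ i j)))"
    by (subst sum.swap) (simp add: sum.distrib[symmetric] inner_add_right distrib_left)
  also have "\<dots> = 0"
    using metric by simp
  finally have cancel: "(\<Sum>j\<le>s. \<omega> j * (2 * (\<Sum>i\<le>s. \<omega> i * (?\<psi> i j \<bullet> MX i j))))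
      + (\<Sum>i\<le>s. \<omega> i * (2 * (\<Sum>j\<le>s. \<omega> j * (?\<psi> i j \<bullet> MZ i j)))) = 0" .
  have "(\<Sum>j\<le>s. \<omega> j * BX j) + (\<Sum>i\<le>s. \<omega> i * BZ i)
    = (\<Sum>j\<le>s. \<omega> j * (2 * (\<Sum>i\<le>s. \<omega> i * (?\<psi> i j \<bullet> MX i j)) + BX j))
      + (\<Sum>i\<le>s. \<omega> i * (2 * (\<Sum>j\<le>s. \<omega> j * (?\<psi> i j \<bullet> MZ i j)) + BZ i))"
    using cancel by (simp add: distrib_left sum.distrib)
  also have "\<dots> \<le> (\<Sum>j\<le>s. \<omega> j * (2 * (\<Sum>i\<le>s. ?a i j * HX i j) + (\<Sum>i\<le>s. ?a i j * (d * \<omega> i * VX i j))))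
      + (\<Sum>i\<le>s. \<omega> i * (2 * (\<Sum>j\<le>s. ?a i j * HZ i j) + (\<Sum>j\<le>s. ?a i j * (d * \<omega> j * VZ i j))))"
    by (intro add_mono sum_mono mult_left_mono X Z \<omega>)
  also have "\<dots> = (\<Sum>j\<le>s. \<Sum>i\<le>s. ?a i j * (2 * (\<omega> j * HX i j) + d * \<omega> i * \<omega> j * VX i j))
      + (\<Sum>i\<le>s. \<Sum>j\<le>s. ?a i j * (2 * (\<omega> i * HZ i j) + d * \<omega> i * \<omega> j * VZ i j))"
    by (simp add: sum_distrib_left sum.distrib distrib_left mult_ac)
  also have "\<dots> = (\<Sum>i\<le>s. \<Sum>j\<le>s. ?a i j * (2 * (\<omega> j * HX i j + \<omega> i * HZ i j) + d * \<omega> i * \<omega> j * (VX i j + VZ i j)))"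
    by (subst sum.swap) (simp add: sum.distrib[symmetric] distrib_left add_ac)
  finally show ?thesis
    by (simp add: BX_def BZ_def HX_def HZ_def VX_def VZ_def sum.distrib)
qed

text \<open>The side terms of \<open>element_volume_inequality\<close> are physical entropy fluxes
  through the edges. Added to the interface corrections in \<open>R_op\<close>, tested with
  \<open>deriv \<eta>\<close>, they dominate \<open>Q\<close> node by node.\<close>

lemma space_entropy_inequality:
  assumes mesh: "dg_mesh G \<Omega>" and \<kappa>: "\<kappa> \<in> elems G"
    and W: "\<And>\<kappa> i j. \<kappa> \<in> elems G \<Longrightarrow> i \<le> degr (sp G) \<Longrightarrow> j \<le> degr (sp G) \<Longrightarrow> W \<kappa> i j \<in> {m..M}"
    and d: "4 * L_flux m M f * Sup (Lu_ratios m M \<theta>) * max_D (sp G) \<le> dk \<kappa>"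
    and h: "interface_flux m M f h" and Q: "numerical_entropy_flux m M f h \<eta> qf Q"
  defines "s \<equiv> degr (sp G)" and "\<omega> \<equiv> wt (sp G)"
  shows "(\<Sum>e\<in>edges G \<kappa>. \<Sum>k\<le>s. \<omega> k * Je G e k * Q (u_space G W \<kappa> (xe G e k))
        (u_space G W (neighbour G \<kappa> e) (xe G e k)) (nrm G \<kappa> e k))
    \<le> (\<Sum>i\<le>s. \<Sum>j\<le>s. deriv \<eta> (W \<kappa> i j) * (R_op G f hec h W \<kappa> i j + V_op G dk W \<kappa> i j))"
proof -
  interpret dg_mesh G \<Omega> by (rule mesh)
  let ?um = "\<lambda>e k. u_space G W \<kappa> (xe G e k)" and ?up = "\<lambda>e k. u_space G W (neighbour G \<kappa> e) (xe G e k)"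
  let ?n = "\<lambda>e k. nrm G \<kappa> e k"
  define Bd where "Bd i j = (\<Sum>e\<in>edges G \<kappa>. \<Sum>k\<le>s. phi G \<kappa> i j (xe G e k) * \<omega> k * Je G e k *
      (h (W \<kappa> i j) (?up e k) (?n e k) - f (W \<kappa> i j) \<bullet> ?n e k))" for i j
  have sides: "(\<Sum>e\<in>edges G \<kappa>. \<Sum>k\<le>s. \<omega> k * Je G e k * (qf (?um e k) \<bullet> ?n e k)) =
      (\<Sum>j\<le>s. \<omega> j * (qf (W \<kappa> s j) \<bullet> n_xi G \<kappa> s s j - qf (W \<kappa> 0 j) \<bullet> n_xi G \<kappa> 0 0 j))
      + (\<Sum>i\<le>s. \<omega> i * (qf (W \<kappa> i s) \<bullet> n_zeta G \<kappa> i s s - qf (W \<kappa> i 0) \<bullet> n_zeta G \<kappa> i 0 0))"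
    unfolding s_def \<omega>_def sum_edges[OF \<kappa>] face_sum[OF \<kappa>, of _ "\<lambda>x. qf (u_space G W \<kappa> x)"]
    by (simp add: face_node_def face_normal_def u_space_node[OF \<kappa>] right_diff_distrib sum_subtractf sum_negf)
  \<comment> \<open>At an edge node only one basis function is nonzero, so the sum over the element
    nodes collapses to the trace from \<open>\<kappa>\<close>.\<close>
  have trace: "(\<Sum>i\<le>s. \<Sum>j\<le>s. deriv \<eta> (W \<kappa> i j) * Bd i j) = (\<Sum>e\<in>edges G \<kappa>. \<Sum>k\<le>s. \<omega> k * Je G e k *
      (deriv \<eta> (?um e k) * (h (?um e k) (?up e k) (?n e k) - f (?um e k) \<bullet> ?n e k)))"
  proof -
    define X where "X e k i j = \<omega> k * Je G e k *
      (deriv \<eta> (W \<kappa> i j) * (h (W \<kappa> i j) (?up e k) (?n e k) - f (W \<kappa> i j) \<bullet> ?n e k))" for e k i j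
    have "(\<Sum>i\<le>s. \<Sum>j\<le>s. deriv \<eta> (W \<kappa> i j) * Bd i j) =
        (\<Sum>i\<le>s. \<Sum>j\<le>s. \<Sum>e\<in>edges G \<kappa>. \<Sum>k\<le>s. phi G \<kappa> i j (xe G e k) * X e k i j)"
      by (simp add: Bd_def X_def sum_distrib_left mult_ac)
    also have "\<dots> = (\<Sum>i\<le>s. \<Sum>e\<in>edges G \<kappa>. \<Sum>k\<le>s. \<Sum>j\<le>s. phi G \<kappa> i j (xe G e k) * X e k i j)"
      by (subst (2) sum.swap, subst (3) sum.swap) (rule refl)
    also have "\<dots> = (\<Sum>e\<in>edges G \<kappa>. \<Sum>k\<le>s. \<Sum>i\<le>s. \<Sum>j\<le>s. phi G \<kappa> i j (xe G e k) * X e k i j)"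
      by (subst sum.swap, subst (2) sum.swap) (rule refl)
    also have "\<dots> = (\<Sum>e\<in>edges G \<kappa>. \<Sum>k\<le>s. \<omega> k * Je G e k *
      (deriv \<eta> (?um e k) * (h (?um e k) (?up e k) (?n e k) - f (?um e k) \<bullet> ?n e k)))"
    proof (intro sum.cong refl)
      fix e k assume e: "e \<in> edges G \<kappa>" and "k \<in> {..s}"
      then have "k \<le> degr (sp G)" by (simp add: s_def)
      then obtain a b where ab: "a \<le> degr (sp G)" "b \<le> degr (sp G)" "xe G e k = node G \<kappa> a b"
        using edge_node[OF \<kappa> e] by blast
      show "(\<Sum>i\<le>s. \<Sum>j\<le>s. phi G \<kappa> i j (xe G e k) * X e k i j) = \<omega> k * Je G e k *
          (deriv \<eta> (?um e k) * (h (?um e k) (?up e k) (?n e k) - f (?um e k) \<bullet> ?n e k))"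
        using sum_phi_node[OF \<kappa> ab(1,2), of "X e k"] u_space_node[OF \<kappa> ab(1,2), of W]
        by (simp only: X_def s_def ab(3))
    qed
    finally show ?thesis .
  qed
  have "(\<Sum>e\<in>edges G \<kappa>. \<Sum>k\<le>s. \<omega> k * Je G e k * Q (?um e k) (?up e k) (?n e k)) \<le>
      (\<Sum>e\<in>edges G \<kappa>. \<Sum>k\<le>s. \<omega> k * Je G e k *
        (deriv \<eta> (?um e k) * (h (?um e k) (?up e k) (?n e k) - f (?um e k) \<bullet> ?n e k) + qf (?um e k) \<bullet> ?n e k))"
  proof (intro sum_mono mult_left_mono)
    fix e k assume e: "e \<in> edges G \<kappa>" and "k \<in> {..s}"
    then have k: "k \<le> degr (sp G)" by (simp add: s_def)
    show "0 \<le> \<omega> k * Je G e k"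
      using gauss_lobatto_wt_pos[OF rule k] Je_pos[OF \<kappa> e k] by (simp add: \<omega>_def)
    show "Q (?um e k) (?up e k) (?n e k) \<le>
        deriv \<eta> (?um e k) * (h (?um e k) (?up e k) (?n e k) - f (?um e k) \<bullet> ?n e k) + qf (?um e k) \<bullet> ?n e k"
    proof (rule interface_entropy_dissipation[OF h Q \<eta>(1)])
      show "?um e k \<in> {m..M}" by (rule u_space_edge_mem[OF W \<kappa> e k])
      show "?up e k \<in> {m..M}" by (rule u_space_edge_mem[OF W neighbour_edge[OF \<kappa> e] k])
      show "norm (?n e k) = 1"
        using normals[OF \<kappa> e k] by (simp add: outward_unit_normal_def)
    qed
  qed
  also have "\<dots> = (\<Sum>i\<le>s. \<Sum>j\<le>s. deriv \<eta> (W \<kappa> i j) * Bd i j)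
      + ((\<Sum>j\<le>s. \<omega> j * (qf (W \<kappa> s j) \<bullet> n_xi G \<kappa> s s j - qf (W \<kappa> 0 j) \<bullet> n_xi G \<kappa> 0 0 j))
      + (\<Sum>i\<le>s. \<omega> i * (qf (W \<kappa> i s) \<bullet> n_zeta G \<kappa> i s s - qf (W \<kappa> i 0) \<bullet> n_zeta G \<kappa> i 0 0)))"
    unfolding trace sides[symmetric] by (simp only: distrib_left sum.distrib)
  also have "\<dots> \<le> (\<Sum>i\<le>s. \<Sum>j\<le>s. deriv \<eta> (W \<kappa> i j) * Bd i j) + (\<Sum>i\<le>s. \<Sum>j\<le>s. deriv \<eta> (W \<kappa> i j) *
        (2 * (\<omega> j * (\<Sum>k\<le>s. Qmat (sp G) i k * hec (W \<kappa> i j) (W \<kappa> k j) (n_xi G \<kappa> i k j))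
            + \<omega> i * (\<Sum>k\<le>s. Qmat (sp G) j k * hec (W \<kappa> i j) (W \<kappa> i k) (n_zeta G \<kappa> i j k)))
        + dk \<kappa> * \<omega> i * \<omega> j * (\<Sum>k\<le>s. \<omega> k / 2 * norm (n_xi G \<kappa> i k j) * (W \<kappa> i j - W \<kappa> k j)
            + \<omega> k / 2 * norm (n_zeta G \<kappa> i j k) * (W \<kappa> i j - W \<kappa> i k))))"
    unfolding s_def \<omega>_def by (intro add_left_mono element_volume_inequality[OF mesh \<kappa> W[OF \<kappa>] d])
  also have "\<dots> = (\<Sum>i\<le>s. \<Sum>j\<le>s. deriv \<eta> (W \<kappa> i j) * (R_op G f hec h W \<kappa> i j + V_op G dk W \<kappa> i j))"
    unfolding sum.distrib[symmetric] distrib_left[symmetric] R_op_def V_op_def Bd_def s_def \<omega>_def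
    by (simp only: add_ac)
  finally show ?thesis .
qed

end

section \<open>Combination of the balances in space and time over one slab\<close>

theorem theorem4p4:
  fixes p q :: nat
    and G :: mesh and T :: quad
    and \<Omega> :: "(real^2) set" and u0 :: "real^2 \<Rightarrow> real" and m M :: real
    and f :: "real \<Rightarrow> real^2"
    and \<theta> :: "real \<Rightarrow> real" and g :: "real \<Rightarrow> real^2"
    and hec h :: "real \<Rightarrow> real \<Rightarrow> real^2 \<Rightarrow> real"
    and Q :: "(real \<Rightarrow> real) \<Rightarrow> (real \<Rightarrow> real^2) \<Rightarrow> real \<Rightarrow> real \<Rightarrow> real^2 \<Rightarrow> real"
    and t :: "nat \<Rightarrow> real" and n :: nat
    and U :: "nat \<Rightarrow> nat \<Rightarrow> (real^2) set \<Rightarrow> nat \<Rightarrow> nat \<Rightarrow> real"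
    and dk :: "(real^2) set \<Rightarrow> real" and dn :: "nat \<Rightarrow> real"
  assumes degrees: "1 \<le> p" "1 \<le> q" "degr (sp G) = p" "degr T = q"
    and mesh: "dg_mesh G \<Omega>"
    and time_rule: "gauss_lobatto T"
    and flux: "locally_lipschitz f"
    and u0: "u0 \<in> borel_measurable (lebesgue_on \<Omega>)"
      "ereal m = - esssup (lebesgue_on \<Omega>) (\<lambda>x. ereal (- u0 x))"
      "ereal M = esssup (lebesgue_on \<Omega>) (\<lambda>x. ereal (u0 x))"
    and theta: "entropy_pair f \<theta> g"
      "\<forall>u. deriv \<theta> field_differentiable at u \<and> 0 < deriv (deriv \<theta>) u"
    and hec: "ec_flux f \<theta> g hec"
    and h: "interface_flux m M f h"
    and Q: "\<forall>\<eta> qf. entropy_pair f \<eta> qf \<longrightarrow> numerical_entropy_flux m M f h \<eta> qf (Q \<eta> qf)"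
    and time_slab: "t 0 = 0" "0 < t (Suc n) - t n"
    and prev_bounds: "\<forall>\<kappa>\<in>elems G. \<forall>i\<le>p. \<forall>j\<le>p. U_prev G T u0 U n \<kappa> i j \<in> {m..M}"
    and bounds: "\<forall>\<kappa>\<in>elems G. \<forall>i\<le>p. \<forall>j\<le>p. \<forall>r\<le>q. U n r \<kappa> i j \<in> {m..M}"
    and scheme: "\<forall>\<kappa>\<in>elems G. \<forall>i\<le>p. \<forall>j\<le>p. \<forall>r\<le>q.
      wt (sp G) i * wt (sp G) j * Jdet G \<kappa> i j *
        T_op T \<theta> (dn n) (\<lambda>r'. U n r' \<kappa> i j) (U_prev G T u0 U n \<kappa> i j) r
      + wt T r * (t (Suc n) - t n) / 2 * (R_op G f hec h (U n r) \<kappa> i j + V_op G dk (U n r) \<kappa> i j) = 0"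
    and Lu_finite: "bdd_above (Lu_ratios m M \<theta>)"
    and dk: "\<forall>\<kappa>\<in>elems G. 4 * L_flux m M f * Sup (Lu_ratios m M \<theta>) * max_D (sp G) \<le> dk \<kappa>"
    and dn: "\<forall>n. 2 * Sup (Lu_ratios m M \<theta>) * max_D T \<le> dn n"
  shows "\<forall>\<eta> qf. entropy_pair f \<eta> qf \<and>
      (\<forall>u. deriv \<eta> field_differentiable at u \<and> 0 \<le> deriv (deriv \<eta>) u) \<longrightarrow>
    (\<forall>\<kappa>\<in>elems G.
      cell_avg G \<eta> (U n q) \<kappa> \<le> cell_avg G \<eta> (U_prev G T u0 U n) \<kappa>
        - (t (Suc n) - t n) / cell_measure G \<kappa> *
          (\<Sum>r\<le>q. wt T r / 2 * (\<Sum>e\<in>edges G \<kappa>. \<Sum>k\<le>p. wt (sp G) k * Je G e k *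
             Q \<eta> qf (u_h G T t U n \<kappa> (xe G e k) (time_node T t n r))
               (u_h G T t U n (neighbour G \<kappa> e) (xe G e k) (time_node T t n r))
               (nrm G \<kappa> e k))))"
proof (intro allI impI ballI)
  fix \<eta> qf \<kappa>
  assume \<eta>: "entropy_pair f \<eta> qf \<and> (\<forall>u. deriv \<eta> field_differentiable at u \<and> 0 \<le> deriv (deriv \<eta>) u)"
    and \<kappa>: "\<kappa> \<in> elems G"
  interpret dg_mesh G \<Omega> by (rule mesh)
  interpret entropy_stable_setting m M f \<theta> g hec \<eta> qf
    using theta hec \<eta> Lu_finite by unfold_locales auto
  define c where "c i j = wt (sp G) i * wt (sp G) j * Jdet G \<kappa> i j" for i j
  define y0 where "y0 = U_prev G T u0 U n \<kappa>"
  define Tr where "Tr i j r = T_op T \<theta> (dn n) (\<lambda>r'. U n r' \<kappa> i j) (y0 i j) r" for i j r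
  define Sp where "Sp i j r = R_op G f hec h (U n r) \<kappa> i j + V_op G dk (U n r) \<kappa> i j" for i j r
  define a where "a i j r = deriv \<eta> (U n r \<kappa> i j)" for i j r
  define Flux where "Flux r = (\<Sum>e\<in>edges G \<kappa>. \<Sum>k\<le>p. wt (sp G) k * Je G e k *
    Q \<eta> qf (u_space G (U n r) \<kappa> (xe G e k)) (u_space G (U n r) (neighbour G \<kappa> e) (xe G e k)) (nrm G \<kappa> e k))" for r
  let ?dt = "t (Suc n) - t n"
  have c: "0 < c i j" if "i \<le> p" "j \<le> p" for i j
    using gauss_lobatto_wt_pos[OF rule] J_pos[OF \<kappa>] that degrees by (simp add: c_def)
  have measure: "0 < cell_measure G \<kappa>"
    unfolding cell_measure_def degrees(3) c_def[symmetric]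
    by (rule sum_pos, simp, simp, rule sum_pos) (simp_all add: c)
  have time: "\<eta> (U n q \<kappa> i j) - \<eta> (y0 i j) \<le> (\<Sum>r\<le>q. a i j r * Tr i j r)" if "i \<le> p" "j \<le> p" for i j
    using time_entropy_inequality[OF time_rule, of "\<lambda>r. U n r \<kappa> i j" "dn n" "y0 i j"] bounds \<kappa> that dn
    by (simp add: degrees a_def Tr_def)
  have space: "Flux r \<le> (\<Sum>i\<le>p. \<Sum>j\<le>p. a i j r * Sp i j r)" if "r \<le> q" for r
    using space_entropy_inequality[OF mesh \<kappa> _ _ h, of "U n r" dk "Q \<eta> qf"] bounds that Q \<eta> dk \<kappa>
    by (simp add: degrees Flux_def a_def Sp_def)
  \<comment> \<open>The scheme trades the time operator for the spatial one at each node of the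
    slab.\<close>
  have scheme': "c i j * Tr i j r = - (wt T r * ?dt / 2 * Sp i j r)" if "i \<le> p" "j \<le> p" "r \<le> q" for i j r
    using scheme \<kappa> that unfolding c_def Tr_def Sp_def y0_def by (simp add: eq_neg_iff_add_eq_0)
  have "(\<Sum>i\<le>p. \<Sum>j\<le>p. c i j * (\<eta> (U n q \<kappa> i j) - \<eta> (y0 i j)))
      \<le> (\<Sum>i\<le>p. \<Sum>j\<le>p. c i j * (\<Sum>r\<le>q. a i j r * Tr i j r))"
    by (intro sum_mono mult_left_mono time less_imp_le[OF c]) auto
  also have "\<dots> = (\<Sum>i\<le>p. \<Sum>j\<le>p. \<Sum>r\<le>q. a i j r * (c i j * Tr i j r))"
    by (simp add: sum_distrib_left mult_ac)
  also have "\<dots> = (\<Sum>i\<le>p. \<Sum>j\<le>p. \<Sum>r\<le>q. - (wt T r * ?dt / 2 * (a i j r * Sp i j r)))"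
    by (intro sum.cong refl) (simp add: scheme')
  also have "\<dots> = (\<Sum>r\<le>q. \<Sum>i\<le>p. \<Sum>j\<le>p. - (wt T r * ?dt / 2 * (a i j r * Sp i j r)))"
    by (subst (2) sum.swap, subst sum.swap) (rule refl)
  also have "\<dots> = - (\<Sum>r\<le>q. wt T r * ?dt / 2 * (\<Sum>i\<le>p. \<Sum>j\<le>p. a i j r * Sp i j r))"
    by (simp only: sum_negf sum_distrib_left)
  \<comment> \<open>The spatial inequality is a lower bound, and it enters with a negative
    sign.\<close>
  also have "\<dots> \<le> - (\<Sum>r\<le>q. wt T r * ?dt / 2 * Flux r)"
    unfolding neg_le_iff_le
    using space gauss_lobatto_wt_pos[OF time_rule] time_slab(2) degrees
    by (intro sum_mono mult_left_mono) (auto intro!: divide_nonneg_pos mult_nonneg_nonneg less_imp_le)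
  also have "\<dots> = - (?dt * (\<Sum>r\<le>q. wt T r / 2 * Flux r))"
    by (simp add: sum_distrib_left mult_ac)
  finally have "(\<Sum>i\<le>p. \<Sum>j\<le>p. c i j * (\<eta> (U n q \<kappa> i j) - \<eta> (y0 i j)))
      \<le> - (?dt * (\<Sum>r\<le>q. wt T r / 2 * Flux r))" .
  from divide_right_mono[OF this less_imp_le[OF measure]]
  have "(\<Sum>i\<le>p. \<Sum>j\<le>p. c i j * (\<eta> (U n q \<kappa> i j) - \<eta> (y0 i j))) / cell_measure G \<kappa>
      \<le> - (?dt / cell_measure G \<kappa> * (\<Sum>r\<le>q. wt T r / 2 * Flux r))"
    by (simp only: minus_divide_left times_divide_eq_left)
  moreover have "cell_avg G \<eta> (U n q) \<kappa> - cell_avg G \<eta> (U_prev G T u0 U n) \<kappa> =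
      (\<Sum>i\<le>p. \<Sum>j\<le>p. c i j * (\<eta> (U n q \<kappa> i j) - \<eta> (y0 i j))) / cell_measure G \<kappa>"
    by (simp add: cell_avg_def degrees c_def y0_def sum_divide_distrib sum_subtractf[symmetric] right_diff_distrib diff_divide_distrib)
  ultimately have "cell_avg G \<eta> (U n q) \<kappa> \<le> cell_avg G \<eta> (U_prev G T u0 U n) \<kappa>
      - ?dt / cell_measure G \<kappa> * (\<Sum>r\<le>q. wt T r / 2 * Flux r)"
    by linarith
  \<comment> \<open>At a time node the space-time function is the spatial one with the degrees of
    freedom of that node, which identifies \<open>Flux r\<close> with the stated boundary
    sum.\<close>
  moreover have "u_h G T t U n \<kappa>' x (time_node T t n r) = u_space G (U n r) \<kappa>' x" if "r \<in> {..q}" for \<kappa>' x r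
    using that time_slab(2) degrees by (intro u_h_time_node[OF time_rule]) auto
  ultimately show "cell_avg G \<eta> (U n q) \<kappa> \<le> cell_avg G \<eta> (U_prev G T u0 U n) \<kappa>
      - ?dt / cell_measure G \<kappa> * (\<Sum>r\<le>q. wt T r / 2 * (\<Sum>e\<in>edges G \<kappa>. \<Sum>k\<le>p. wt (sp G) k * Je G e k *
          Q \<eta> qf (u_h G T t U n \<kappa> (xe G e k) (time_node T t n r))
            (u_h G T t U n (neighbour G \<kappa> e) (xe G e k) (time_node T t n r)) (nrm G \<kappa> e k)))"
    by (simp add: Flux_def)
qed

end
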